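(* Suppose that the inflow rate $u$ is piecewise constant, i.e., there is an increasing sequence $(\xi_k)_{k\in\mathbb{N}}$ with $\xi_0=0$ and $\xi_k\to\infty$ such that $u$ is constant on each interval $[\xi_k,\xi_{k+1})$ (and $u=0$ on $(-\infty,0)$). Then there exists a strong dynamic equilibrium $f=(f^+,f^-)$ which is right-constant (every $f_e^+$ and $f_e^-$, $e\in E$, is right-constant) and whose earliest-time functions $\ell_v$, $v\in V$, are right-linear.
   Context: Network. $G=(V,E)$ is a finite directed graph without loops and with at most one edge from $v$ to $w$ for every pair of nodes; an edge from $v$ to $w$ is written $e=vw$, and $\delta^+(v),\delta^-(v)$ are the sets of edges leaving and entering $v$. Each edge has a service rate $\nu_e>0$ and a travel time $\tau_e\ge 0$. There are a source $s$ and a sink $t\neq s$; every node is reachable from $s$ by a directed path; and $\sum_{e\in C}\tau_e>0$ for every directed cycle $C$. $\mathcal F_0(\mathbb R)$ is the set of nonnegative locally integrable functions on $\mathbb R$ that vanish a.e. on $(-\infty,0)$. The inflow rate is $u\in\mathcal F_0(\mathbb R)$. Flows over time. A flow-over-time is a pair $f=(f^+,f^-)$ of arrays of functions $f_e^+,f_e^-\in\mathcal F_0(\mathbb R)$, $e\in E$. Put $F_e^\pm(\theta)=\int_0^\theta f_e^\pm(\xi)\,d\xi$ and $z_e(\theta)=F_e^+(\theta)-F_e^-(\theta+\tau_e)$ (queue size). $f$ is feasible if for almost all $\theta$: $f_e^-(\theta)\le\nu_e$ and $z_e(\theta)\ge0$ for each $e$, and $\sum_{e\in\delta^+(v)}f_e^+(\theta)-\sum_{e\in\delta^-(v)}f_e^-(\theta)$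 equals $u(\theta)$ for $v=s$ and $0$ for $v\in V\setminus\{s,t\}$. It is always assumed that queues operate at capacity: for each $e$ and almost all $\theta$, $f_e^-(\theta+\tau_e)=\nu_e$ if $z_e(\theta)>0$ and $f_e^-(\theta+\tau_e)=\min\{f_e^+(\theta),\nu_e\}$ otherwise. Travel times. $T_e(\theta)=\theta+z_e(\theta)/\nu_e+\tau_e$. For a directed path $P=(e_1,\dots,e_k)$, $\ell^P(\theta)=T_{e_k}\circ\cdots\circ T_{e_1}(\theta)$. The earliest-time functions are $\ell_w(\theta)=\min_{P}\ell^P(\theta)$ over all directed $s$-$w$ paths $P$, with $\ell_s(\theta)=\theta$. An edge $e=vw$ is active at $\theta$, written $e\in E'_\theta$, if $T_e(\ell_v(\theta))\le\ell_w(\theta)$ (equivalently, equality holds). Strong equilibrium. A feasible flow-over-time $f$ is a strong dynamic equilibrium if for each $e=vw\in E$ and almost all $\theta$: $e\notin E'_\theta$ implies $f_e^+(\ell_v(\theta))=0$. A function $g:\mathbb R\to\mathbb R$ is right-constant if for each $\theta\in\mathbb R$ there is $\epsilon>0$ such that $g$ is constant on $[\theta,\theta+\epsilon)$; it is right-linear if for each $\theta$ there is $\epsilon>0$ such that $g$ is affine on $[\theta,\theta+\epsilon)$.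
   Formalization: Each inflow rate f_e^+ is only shown to agree almost everywhere with a right-constant function: where ℓ_v is constant while e is inactive, the strong equilibrium condition can force f_e^+ to be 0 at a point right after which it is positive, so pointwise right-constancy of f_e^+ can fail. *)

theory Defs
  imports "HOL-Analysis.Analysis" "Graph_Theory.Arc_Walk"
begin

text \<open>
  Networks are digraphs in the sense of \<^locale>\<open>digraph\<close> (finite, loop-free, no two arcs
  with the same tail and head) with service rates \<open>\<nu>\<close>, travel times \<open>\<tau>\<close>, a source \<open>s\<close> and a
  sink \<open>t\<close>.
\<close>

locale network = digraph G
  for G :: "('a, 'b) pre_digraph" and \<nu> \<tau> :: "'b \<Rightarrow> real" and s t :: 'a +
  assumes service_rate_pos: "e \<in> arcs G \<Longrightarrow> 0 < \<nu> e"
    and travel_time_nonneg: "e \<in> arcs G \<Longrightarrow> 0 \<le> \<tau> e"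
    and source_in_verts: "s \<in> verts G"
    and sink_in_verts: "t \<in> verts G"
    and sink_neq_source: "t \<noteq> s"
    and reachable_from_source: "v \<in> verts G \<Longrightarrow> reachable G s v"
    and cycle_travel_time_pos: "pre_digraph.cycle G C \<Longrightarrow> 0 < (\<Sum>e\<in>set C. \<tau> e)"

definition F0 :: "(real \<Rightarrow> real) set" where
  "F0 = {g. (\<forall>\<theta>. 0 \<le> g \<theta>) \<and> (\<forall>a b. g absolutely_integrable_on {a..b})
          \<and> (AE \<theta> in lebesgue. \<theta> < 0 \<longrightarrow> g \<theta> = 0)}"

text \<open>
  A pair \<open>f = (f\<^sup>+, f\<^sup>-)\<close> of edge inflow and outflow rates; values at elements of \<open>'b\<close> that are
  not arcs are irrelevant.
\<close>

type_synonym 'b flow = "('b \<Rightarrow> real \<Rightarrow> real) \<times> ('b \<Rightarrow> real \<Rightarrow> real)"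

abbreviation inflow :: "'b flow \<Rightarrow> 'b \<Rightarrow> real \<Rightarrow> real" where
  "inflow f \<equiv> fst f"

abbreviation outflow :: "'b flow \<Rightarrow> 'b \<Rightarrow> real \<Rightarrow> real" where
  "outflow f \<equiv> snd f"

definition flow_over_time :: "('a, 'b) pre_digraph \<Rightarrow> 'b flow \<Rightarrow> bool" where
  "flow_over_time G f \<longleftrightarrow> (\<forall>e\<in>arcs G. inflow f e \<in> F0 \<and> outflow f e \<in> F0)"

definition cumulative :: "(real \<Rightarrow> real) \<Rightarrow> real \<Rightarrow> real" where
  "cumulative g \<theta> = (LINT \<xi>=0..\<theta>|lebesgue. g \<xi>)"

definition queue :: "('b \<Rightarrow> real) \<Rightarrow> 'b flow \<Rightarrow> 'b \<Rightarrow> real \<Rightarrow> real" where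
  "queue \<tau> f e \<theta> = cumulative (inflow f e) \<theta> - cumulative (outflow f e) (\<theta> + \<tau> e)"

definition feasible ::
  "('a, 'b) pre_digraph \<Rightarrow> ('b \<Rightarrow> real) \<Rightarrow> ('b \<Rightarrow> real) \<Rightarrow> 'a \<Rightarrow> 'a \<Rightarrow> (real \<Rightarrow> real) \<Rightarrow> 'b flow \<Rightarrow> bool"
where
  "feasible G \<nu> \<tau> s t u f \<longleftrightarrow>
     (AE \<theta> in lebesgue.
        (\<forall>e\<in>arcs G. outflow f e \<theta> \<le> \<nu> e \<and> 0 \<le> queue \<tau> f e \<theta>) \<and>
        (\<forall>v\<in>verts G - {t}.
           (\<Sum>e\<in>out_arcs G v. inflow f e \<theta>) - (\<Sum>e\<in>in_arcs G v. outflow f e \<theta>)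
             = (if v = s then u \<theta> else 0)))"

definition queues_operate_at_capacity ::
  "('a, 'b) pre_digraph \<Rightarrow> ('b \<Rightarrow> real) \<Rightarrow> ('b \<Rightarrow> real) \<Rightarrow> 'b flow \<Rightarrow> bool"
where
  "queues_operate_at_capacity G \<nu> \<tau> f \<longleftrightarrow>
     (\<forall>e\<in>arcs G. AE \<theta> in lebesgue.
        outflow f e (\<theta> + \<tau> e)
          = (if 0 < queue \<tau> f e \<theta> then \<nu> e else min (inflow f e \<theta>) (\<nu> e)))"

definition exit_time :: "('b \<Rightarrow> real) \<Rightarrow> ('b \<Rightarrow> real) \<Rightarrow> 'b flow \<Rightarrow> 'b \<Rightarrow> real \<Rightarrow> real" where
  "exit_time \<nu> \<tau> f e \<theta> = \<theta> + queue \<tau> f e \<theta> / \<nu> e + \<tau> e"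

text \<open>The first arc of the path is applied first, as in \<open>T\<^bsub>e\<^sub>k\<^esub> \<circ> \<dots> \<circ> T\<^bsub>e\<^sub>1\<^esub>\<close>.\<close>

definition path_exit_time ::
  "('b \<Rightarrow> real) \<Rightarrow> ('b \<Rightarrow> real) \<Rightarrow> 'b flow \<Rightarrow> 'b list \<Rightarrow> real \<Rightarrow> real"
where
  "path_exit_time \<nu> \<tau> f P \<theta> = fold (exit_time \<nu> \<tau> f) P \<theta>"

text \<open>
  The minimum ranges over the paths without repeated vertices, a finite set that is nonempty
  in a network. The only such path from \<open>s\<close> to \<open>s\<close> is the empty one, see \<open>earliest_time_source\<close>.
\<close>

definition earliest_time ::
  "('a, 'b) pre_digraph \<Rightarrow> ('b \<Rightarrow> real) \<Rightarrow> ('b \<Rightarrow> real) \<Rightarrow> 'a \<Rightarrow> 'b flow \<Rightarrow> 'a \<Rightarrow> real \<Rightarrow> real"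
where
  "earliest_time G \<nu> \<tau> s f w \<theta> =
     Min ((\<lambda>P. path_exit_time \<nu> \<tau> f P \<theta>) ` {P. pre_digraph.apath G s P w})"

lemma (in network) earliest_time_source: "earliest_time G \<nu> \<tau> s f s \<theta> = \<theta>"
proof -
  have "{P. apath s P s} = {[]}"
  proof (intro equalityI subsetI)
    fix P assume "P \<in> {P. apath s P s}"
    then have P: "awalk s P s" "distinct (awalk_verts s P)"
      by (auto simp: apath_def)
    show "P \<in> {[]}"
    proof (cases P)
      case (Cons e es)
      have "last (awalk_verts (head G e) es) = s"
        using P(1) Cons awalkE[OF P(1)] by (metis awalk_verts.simps(2) awalk_verts_non_Nil last_ConsR)
      then have "s \<in> set (awalk_verts (head G e) es)"
        by (metis awalk_verts_non_Nil last_in_set)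
      then show ?thesis
        using P Cons by (auto simp: awalk_Cons_iff)
    qed simp
  qed (auto simp: apath_Nil_iff source_in_verts)
  then show ?thesis
    by (simp add: earliest_time_def path_exit_time_def)
qed

definition active ::
  "('a, 'b) pre_digraph \<Rightarrow> ('b \<Rightarrow> real) \<Rightarrow> ('b \<Rightarrow> real) \<Rightarrow> 'a \<Rightarrow> 'b flow \<Rightarrow> real \<Rightarrow> 'b set"
where
  "active G \<nu> \<tau> s f \<theta> =
     {e \<in> arcs G. exit_time \<nu> \<tau> f e (earliest_time G \<nu> \<tau> s f (tail G e) \<theta>)
                    \<le> earliest_time G \<nu> \<tau> s f (head G e) \<theta>}"

definition strong_dynamic_equilibrium ::
  "('a, 'b) pre_digraph \<Rightarrow> ('b \<Rightarrow> real) \<Rightarrow> ('b \<Rightarrow> real) \<Rightarrow> 'a \<Rightarrow> 'a \<Rightarrow> (real \<Rightarrow> real) \<Rightarrow> 'b flow \<Rightarrow> bool"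
where
  "strong_dynamic_equilibrium G \<nu> \<tau> s t u f \<longleftrightarrow>
     flow_over_time G f \<and> feasible G \<nu> \<tau> s t u f \<and> queues_operate_at_capacity G \<nu> \<tau> f \<and>
     (\<forall>e\<in>arcs G. AE \<theta> in lebesgue.
        e \<notin> active G \<nu> \<tau> s f \<theta> \<longrightarrow> inflow f e (earliest_time G \<nu> \<tau> s f (tail G e) \<theta>) = 0)"

definition right_constant :: "(real \<Rightarrow> real) \<Rightarrow> bool" where
  "right_constant g \<longleftrightarrow> (\<forall>\<theta>. \<exists>\<epsilon>>0. g constant_on {\<theta>..<\<theta> + \<epsilon>})"

text \<open>
  Elements of \<open>F0\<close> are determined up to null sets, and this variant of \<open>right_constant\<close> does
  not depend on the representative. The condition of a strong equilibrium does: if \<open>l\<^sub>v\<close> is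
  constant with value \<open>p\<close> on an interval of times at which an arc \<open>e\<close> leaving \<open>v\<close> is inactive,
  it forces \<open>f\<^sub>e\<^sup>+ p = 0\<close>, even if \<open>e\<close> becomes active at the end of the interval and
  \<open>f\<^sub>e\<^sup>+\<close> is a positive constant immediately after \<open>p\<close>. Hence one and the same representative of
  the inflow rates cannot in general satisfy this condition and be right-constant at such
  points \<open>p\<close>.
\<close>

definition right_constant_AE :: "(real \<Rightarrow> real) \<Rightarrow> bool" where
  "right_constant_AE h \<longleftrightarrow> (\<exists>g. right_constant g \<and> (AE \<theta> in lebesgue. h \<theta> = g \<theta>))"

definition right_linear :: "(real \<Rightarrow> real) \<Rightarrow> bool" where
  "right_linear g \<longleftrightarrow> (\<forall>\<theta>. \<exists>\<epsilon>>0. \<exists>a b. \<forall>x\<in>{\<theta>..<\<theta> + \<epsilon>}. g x = a * x + b)"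

end

(*
  Proof idea.  Let l v (theta) be the earliest arrival time at v of flow leaving s at time theta and
  X e (theta) the flow that has entered e by then.  As long as the inflow rate is constant, the
  right derivatives (d, x) of (l, X) have to form a thin flow with resetting: x is a static flow
  on the active arcs and d w is the minimum, attained on all arcs carrying flow, of the slopes that
  the active arcs entering w allow.  Such a pair exists for every admissible state: it solves a
  nonlinear complementarity problem on a box, for which Kuhn's combinatorial lemma suffices.  A thin
  flow for a state remains one while it is followed for a short time, the speeds are bounded and the
  admissible states form a closed set, so Zorn's lemma glues the phases, even if they accumulate, to
  a right-linear trajectory on the whole time axis.

  The trajectory determines the flow: X e = F_e^+ o l v = F_e^- o l w for e = vw gives the rates
  f_e^+ = (x e / d v) o r v and f_e^- = (x e / d w) o r w, where r v is the right-continuous inverse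
  of l v.  Comparing slopes yields z_e (l v) = nu_e * max 0 (l w - l v - tau_e), hence
  T_e (l v) = max (l v + tau_e) (l w).  So the functions l are the earliest times, and the
  remaining conditions can be checked point by point, away from the countably many times p at which
  some l v is constant with value p on an interval.
*)
theory Submission
  imports Defs "Graph_Theory.Shortest_Path" "Graph_Theory.Digraph_Component"
begin

section \<open>Complementarity on a box\<close>

text \<open>The departure time \<theta> from \<open>s\<close> as common clock removes the delays:
  each arc is observed at the local time \<open>l v \<theta>\<close> of its tail, so a state is a
  finite family of numbers without history, and queues are read off from the labels
  \<open>l\<close>. The only invariant on the labels is that every vertex other than
  \<open>s\<close> is entered by a tight arc. It is enough for a thin flow to exist, it survives
  limits, and shortest-path distances satisfy it at time 0. Single arcs may have travel time zero;
  positive travel times of cycles still make the tight arcs acyclic, and inductions over vertices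
  run along them. Two obstacles shape the rest. Linear pieces may accumulate from the left, so they
  cannot be enumerated in order: statements are pushed to the right along one piece and taken to
  limits by continuity. And a label may stand still for a while. Then the inverse \<open>r v\<close>
  jumps, but no flow passes through \<open>v\<close> meanwhile, so cumulative flows stay continuous
  in the local time of \<open>v\<close>.\<close>

lemma bounded_seq_finite_subseq:
  fixes f :: "nat \<Rightarrow> 'i \<Rightarrow> real"
  assumes "finite I" "\<And>n i. i \<in> I \<Longrightarrow> f n i \<in> {a i..b i}"
  obtains r z where "strict_mono (r :: nat \<Rightarrow> nat)"
    "\<And>i. i \<in> I \<Longrightarrow> (\<lambda>n. f (r n) i) \<longlonglongrightarrow> z i"
proof -
  have "\<exists>r z. strict_mono (r :: nat \<Rightarrow> nat) \<and> (\<forall>i\<in>I. (\<lambda>n. f (r n) i) \<longlonglongrightarrow> z i)"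
    using assms
  proof (induction I)
    case empty
    show ?case by (auto intro!: exI[of _ id] strict_mono_id)
  next
    case (insert j I)
    then obtain r z where r: "strict_mono r" "\<And>i. i \<in> I \<Longrightarrow> (\<lambda>n. f (r n) i) \<longlonglongrightarrow> z i"
      by (metis insertCI)
    have "seq_compact {a j..b j}" by (rule compact_imp_seq_compact) simp
    moreover have "\<forall>n. f (r n) j \<in> {a j..b j}" using insert.prems by auto
    ultimately obtain l q where q: "strict_mono (q :: nat \<Rightarrow> nat)" "((\<lambda>n. f (r n) j) \<circ> q) \<longlonglongrightarrow> l"
      unfolding seq_compact_def by (auto dest!: spec[of _ "\<lambda>n. f (r n) j"])
    then have q': "(\<lambda>n. f (r (q n)) j) \<longlonglongrightarrow> l" by (simp add: comp_def)
    have "(\<lambda>n. f (r (q n)) i) \<longlonglongrightarrow> z i" if "i \<in> I" for i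
      using LIMSEQ_subseq_LIMSEQ[OF r(2)[OF that] q(1)] by (simp add: comp_def)
    with q' insert.hyps strict_mono_o[OF r(1) q(1), unfolded comp_def] show ?case
      by (intro exI[of _ "\<lambda>a. r (q a)"] exI[of _ "z(j := l)"]) auto
  qed
  with that show ?thesis by blast
qed

text \<open>The labels on a grid record the sign of \<open>F\<close> in each coordinate, with the
  values on the two faces that Kuhn's lemma prescribes. It yields a cell having, for every
  coordinate, corners of both labels. Label 1 off the upper face means \<open>F\<close> is
  nonnegative, label 0 off the lower face that it is negative; both signs pass to the limit as the
  cells shrink to a point.\<close>

lemma box_complementarity_nat:
  fixes F :: "(nat \<Rightarrow> real) \<Rightarrow> nat \<Rightarrow> real" and m :: "nat \<Rightarrow> real"
  assumes m: "\<And>i. i < n \<Longrightarrow> 0 < m i"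
    and cont: "\<And>Z z i. (\<And>j. j < n \<Longrightarrow> (\<lambda>k. Z k j) \<longlonglongrightarrow> z j) \<Longrightarrow> i < n \<Longrightarrow> (\<lambda>k. F (Z k) i) \<longlonglongrightarrow> F z i"
  obtains z where "\<And>i. i < n \<Longrightarrow> 0 \<le> z i \<and> z i \<le> m i"
    "\<And>i. i < n \<Longrightarrow> z i < m i \<Longrightarrow> 0 \<le> F z i" "\<And>i. i < n \<Longrightarrow> 0 < z i \<Longrightarrow> F z i \<le> 0"
proof -
  define g where "g p x = (\<lambda>i. m i * real (x i) / real p)" for p :: nat and x :: "nat \<Rightarrow> nat"
  define lab where "lab p x i = (if x i = 0 then 0 else if x i = p then 1 else if 0 \<le> F (g p x) i then 1 else (0::nat))"
    for p x i
  define good where "good p q r s i \<longleftrightarrow> (\<forall>j<n. q j \<le> r j \<and> r j \<le> q j + 1) \<and>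
     (\<forall>j<n. q j \<le> s j \<and> s j \<le> q j + 1) \<and> lab (Suc p) r i = 1 \<and> lab (Suc p) s i = 0"
    for p and q r s :: "nat \<Rightarrow> nat" and i
  have "\<exists>q. (\<forall>i<n. q i < Suc p) \<and> (\<forall>i<n. \<exists>r s. good p q r s i)" for p
  proof -
    have "\<forall>x. (\<forall>i<n. x i \<le> Suc p) \<longrightarrow> (\<forall>i<n. lab (Suc p) x i = 0 \<or> lab (Suc p) x i = 1)"
      "\<forall>x. (\<forall>i<n. x i \<le> Suc p) \<longrightarrow> (\<forall>i<n. x i = 0 \<longrightarrow> lab (Suc p) x i = 0)"
      "\<forall>x. (\<forall>i<n. x i \<le> Suc p) \<longrightarrow> (\<forall>i<n. x i = Suc p \<longrightarrow> lab (Suc p) x i = 1)"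
      by (auto simp: lab_def)
    then obtain q where q: "\<forall>i<n. q i < Suc p"
      "\<forall>i<n. \<exists>r s. (\<forall>j<n. q j \<le> r j \<and> r j \<le> q j + 1) \<and>
         (\<forall>j<n. q j \<le> s j \<and> s j \<le> q j + 1) \<and> lab (Suc p) r i \<noteq> lab (Suc p) s i"
      by (rule kuhn_lemma[OF zero_less_Suc])
    have "\<exists>r s. good p q r s i" if "i < n" for i
    proof -
      from q(2) that obtain r s where rs: "\<forall>j<n. q j \<le> r j \<and> r j \<le> q j + 1"
         "\<forall>j<n. q j \<le> s j \<and> s j \<le> q j + 1" "lab (Suc p) r i \<noteq> lab (Suc p) s i"
        by blast
      consider "lab (Suc p) r i = 1" "lab (Suc p) s i = 0" | "lab (Suc p) s i = 1" "lab (Suc p) r i = 0"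
        using rs(3) by (simp add: lab_def split: if_splits)
      then show ?thesis using rs(1,2) unfolding good_def by cases blast+
    qed
    with q(1) show ?thesis by blast
  qed
  then obtain Q where Q: "\<And>p i. i < n \<Longrightarrow> Q p i < Suc p" and "\<forall>p. \<forall>i<n. \<exists>r s. good p (Q p) r s i"
    by metis
  then obtain R S where good: "\<And>p i. i < n \<Longrightarrow> good p (Q p) (R p i) (S p i) i"
    by metis
  have R: "\<And>p i j. i < n \<Longrightarrow> j < n \<Longrightarrow> Q p j \<le> R p i j \<and> R p i j \<le> Q p j + 1"
    and S: "\<And>p i j. i < n \<Longrightarrow> j < n \<Longrightarrow> Q p j \<le> S p i j \<and> S p i j \<le> Q p j + 1"
    and labR: "\<And>p i. i < n \<Longrightarrow> lab (Suc p) (R p i) i = 1"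
    and labS: "\<And>p i. i < n \<Longrightarrow> lab (Suc p) (S p i) i = 0"
    using good by (auto simp: good_def)
  have box: "g (Suc p) (Q p) i \<in> {0..m i}" if "i \<in> {..<n}" for p i
    using that m[of i] Q[of i p] mult_left_mono[of "real (Q p i)" "real (Suc p)" "m i"]
    by (auto simp: g_def field_simps)
  obtain r z where r: "strict_mono (r :: nat \<Rightarrow> nat)"
    and z: "\<And>i. i \<in> {..<n} \<Longrightarrow> (\<lambda>k. g (Suc (r k)) (Q (r k)) i) \<longlonglongrightarrow> z i"
    using bounded_seq_finite_subseq[of "{..<n}" "\<lambda>p. g (Suc p) (Q p)" "\<lambda>i. 0" m, OF _ box] by auto
  have null: "(\<lambda>k. m j / real (Suc (r k))) \<longlonglongrightarrow> 0" for j
    using LIMSEQ_subseq_LIMSEQ[OF LIMSEQ_Suc[OF lim_const_over_n[of "m j"]] r] by (simp add: comp_def)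
  have near: "(\<lambda>k. g (Suc (r k)) (T k) j) \<longlonglongrightarrow> z j"
    if j: "j < n" and T: "\<And>k. Q (r k) j \<le> T k j \<and> T k j \<le> Q (r k) j + 1" for T j
  proof (rule tendsto_sandwich[of "\<lambda>k. g (Suc (r k)) (Q (r k)) j" _ _ "\<lambda>k. g (Suc (r k)) (Q (r k)) j + m j / real (Suc (r k))"])
    show "(\<lambda>k. g (Suc (r k)) (Q (r k)) j) \<longlonglongrightarrow> z j" using z j by auto
    from tendsto_add[OF this null[of j]]
    show "(\<lambda>k. g (Suc (r k)) (Q (r k)) j + m j / real (Suc (r k))) \<longlonglongrightarrow> z j" by simp
    show "\<forall>\<^sub>F k in sequentially. g (Suc (r k)) (Q (r k)) j \<le> g (Suc (r k)) (T k) j"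
      using T m[OF j] by (auto simp: g_def intro!: always_eventually divide_right_mono mult_left_mono)
    have "m j * real (T k j) \<le> m j * (real (Q (r k) j) + 1)" for k
      using T[of k] m[OF j] by (intro mult_left_mono) auto
    then show "\<forall>\<^sub>F k in sequentially. g (Suc (r k)) (T k) j \<le> g (Suc (r k)) (Q (r k)) j + m j / real (Suc (r k))"
      by (auto simp: g_def add_divide_distrib[symmetric] distrib_left intro!: always_eventually divide_right_mono)
  qed
  have FR: "(\<lambda>k. F (g (Suc (r k)) (R (r k) i)) i) \<longlonglongrightarrow> F z i" if "i < n" for i
    using that R by (intro cont near) auto
  have FS: "(\<lambda>k. F (g (Suc (r k)) (S (r k) i)) i) \<longlonglongrightarrow> F z i" if "i < n" for i
    using that S by (intro cont near) auto
  show thesis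
  proof (rule that)
    fix i assume i: "i < n"
    show "0 \<le> z i \<and> z i \<le> m i"
    proof
      show "0 \<le> z i" by (rule LIMSEQ_le_const[OF z]) (use i box in auto)
      show "z i \<le> m i" by (rule LIMSEQ_le_const2[OF z]) (use i box in auto)
    qed
  next
    fix i assume i: "i < n" "z i < m i"
    have "(\<lambda>k. g (Suc (r k)) (R (r k) i) i) \<longlonglongrightarrow> z i" using i R by (intro near) auto
    then have "\<forall>\<^sub>F k in sequentially. g (Suc (r k)) (R (r k) i) i < m i"
      using i by (auto dest: order_tendstoD)
    then have "\<forall>\<^sub>F k in sequentially. 0 \<le> F (g (Suc (r k)) (R (r k) i)) i"
    proof eventually_elim
      case (elim k)
      then have "R (r k) i i \<noteq> Suc (r k)" by (auto simp: g_def)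
      with labR[OF i(1), of "r k"] show ?case by (auto simp: lab_def split: if_splits)
    qed
    with FR[OF i(1)] show "0 \<le> F z i" by (intro tendsto_lowerbound) auto
  next
    fix i assume i: "i < n" "0 < z i"
    have "(\<lambda>k. g (Suc (r k)) (S (r k) i) i) \<longlonglongrightarrow> z i" using i S by (intro near) auto
    then have "\<forall>\<^sub>F k in sequentially. 0 < g (Suc (r k)) (S (r k) i) i"
      using i by (auto dest: order_tendstoD)
    then have "\<forall>\<^sub>F k in sequentially. F (g (Suc (r k)) (S (r k) i)) i \<le> 0"
    proof eventually_elim
      case (elim k)
      then have "S (r k) i i \<noteq> 0" by (intro notI) (simp add: g_def)
      with labS[OF i(1), of "r k"] show ?case by (auto simp: lab_def split: if_splits)
    qed
    with FS[OF i(1)] show "F z i \<le> 0" by (intro tendsto_upperbound) auto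
  qed
qed

lemma box_complementarity:
  fixes F :: "('i \<Rightarrow> real) \<Rightarrow> 'i \<Rightarrow> real" and m :: "'i \<Rightarrow> real"
  assumes "finite I" and m: "\<And>i. i \<in> I \<Longrightarrow> 0 < m i"
    and cont: "\<And>Z z i. (\<And>j. (\<lambda>k. Z k j) \<longlonglongrightarrow> z j) \<Longrightarrow> i \<in> I \<Longrightarrow> (\<lambda>k. F (Z k) i) \<longlonglongrightarrow> F z i"
  obtains z where "\<And>i. i \<notin> I \<Longrightarrow> z i = 0" "\<And>i. i \<in> I \<Longrightarrow> 0 \<le> z i \<and> z i \<le> m i"
    "\<And>i. i \<in> I \<Longrightarrow> z i < m i \<Longrightarrow> 0 \<le> F z i" "\<And>i. i \<in> I \<Longrightarrow> 0 < z i \<Longrightarrow> F z i \<le> 0"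
proof -
  obtain b where b: "bij_betw b {..<card I} I"
    using ex_bij_betw_nat_finite[OF \<open>finite I\<close>] by (auto simp: atLeast0LessThan)
  define c where "c = inv_into {..<card I} b"
  have bc: "b (c i) = i" "c i < card I" if "i \<in> I" for i
    using that b unfolding c_def
    by (auto simp: bij_betw_inv_into_right dest: bij_betw_inv_into[THEN bij_betwE])
  have bI: "b k \<in> I" and cb: "c (b k) = k" if "k < card I" for k
    using that b unfolding c_def by (auto simp: bij_betw_inv_into_left dest: bij_betwE)
  \<comment> \<open>Extension by 0 off \<open>I\<close> lets convergence on \<open>I\<close> imply
    convergence at every index, as \<open>cont\<close> presupposes.\<close>
  define ext where "ext y = (\<lambda>i. if i \<in> I then y (c i) else (0::real))" for y
  obtain y where y: "\<And>k. k < card I \<Longrightarrow> 0 \<le> y k \<and> y k \<le> m (b k)"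
    "\<And>k. k < card I \<Longrightarrow> y k < m (b k) \<Longrightarrow> 0 \<le> F (ext y) (b k)"
    "\<And>k. k < card I \<Longrightarrow> 0 < y k \<Longrightarrow> F (ext y) (b k) \<le> 0"
  proof (rule box_complementarity_nat[of "card I" "m \<circ> b" "\<lambda>y k. F (ext y) (b k)"])
    fix Z z k assume "\<And>j. j < card I \<Longrightarrow> (\<lambda>k. Z k j) \<longlonglongrightarrow> (z j :: real)" "k < card I"
    then show "(\<lambda>n. F (ext (Z n)) (b k)) \<longlonglongrightarrow> F (ext z) (b k)"
      by (intro cont bI) (auto simp: ext_def bc)
  qed (use m bI in auto)
  show thesis
  proof (rule that[of "ext y"])
    fix i assume i: "i \<in> I"
    show "0 \<le> ext y i \<and> ext y i \<le> m i" using y(1)[of "c i"] i by (simp add: ext_def bc)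
    show "ext y i < m i \<Longrightarrow> 0 \<le> F (ext y) i" using y(2)[of "c i"] i by (simp add: ext_def bc)
    show "0 < ext y i \<Longrightarrow> F (ext y) i \<le> 0" using y(3)[of "c i"] i by (simp add: ext_def bc)
  qed (simp add: ext_def)
qed

section \<open>Right-linear evolutions\<close>

text \<open>
  Zorn's lemma is applied to the graphs of partial trajectories. The Lipschitz condition on pairs
  of points is preserved by unions of chains, makes a graph single-valued, and provides the limit
  state if infinitely many phases accumulate.
\<close>

lemma right_linear_evolution:
  fixes J :: "real \<Rightarrow> ('c \<Rightarrow> real) \<Rightarrow> bool" and P :: "real \<Rightarrow> ('c \<Rightarrow> real) \<Rightarrow> ('c \<Rightarrow> real) \<Rightarrow> bool"
    and L :: "real \<Rightarrow> real"
  defines "move y h d \<equiv> (\<lambda>i. y i + h * d i)"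
  assumes J0: "J 0 y0"
    and closed: "\<And>\<Theta> Y \<theta> y. (\<And>n. J (\<Theta> n) (Y n)) \<Longrightarrow> \<Theta> \<longlonglongrightarrow> \<theta> \<Longrightarrow> (\<And>i. (\<lambda>n. Y n i) \<longlonglongrightarrow> y i) \<Longrightarrow> J \<theta> y"
    and step: "\<And>\<theta> y. 0 \<le> \<theta> \<Longrightarrow> J \<theta> y \<Longrightarrow> \<exists>d. (\<forall>i. \<bar>d i\<bar> \<le> L \<theta>) \<and> P \<theta> y d \<and>
      (\<forall>\<^sub>F h in at_right 0. J (\<theta> + h) (move y h d) \<and> P (\<theta> + h) (move y h d) d)"
    and L: "\<And>a b. 0 \<le> a \<Longrightarrow> a \<le> b \<Longrightarrow> L a \<le> L b"
  obtains Y D where "Y 0 = y0" "\<And>\<theta>. 0 \<le> \<theta> \<Longrightarrow> J \<theta> (Y \<theta>) \<and> P \<theta> (Y \<theta>) (D \<theta>)"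
    "\<And>\<theta>. 0 \<le> \<theta> \<Longrightarrow> \<forall>\<^sub>F h in at_right 0. Y (\<theta> + h) = move (Y \<theta>) h (D \<theta>) \<and> D (\<theta> + h) = D \<theta>"
    "\<And>\<theta> \<theta>' i. 0 \<le> \<theta> \<Longrightarrow> \<theta> \<le> \<theta>' \<Longrightarrow> \<bar>Y \<theta> i - Y \<theta>' i\<bar> \<le> L \<theta>' * (\<theta>' - \<theta>)"
proof -
  define A where "A = {g. (\<forall>\<theta> y. (\<theta>, y) \<in> g \<longrightarrow> 0 \<le> \<theta> \<and> J \<theta> y \<and> (\<theta> = 0 \<longrightarrow> y = y0))
     \<and> (\<forall>\<theta> y x. (\<theta>, y) \<in> g \<longrightarrow> 0 \<le> x \<longrightarrow> x \<le> \<theta> \<longrightarrow> x \<in> fst ` g)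
     \<and> (\<forall>\<theta> y \<theta>' y'. (\<theta>, y) \<in> g \<longrightarrow> (\<theta>', y') \<in> g \<longrightarrow> \<theta> \<le> \<theta>' \<longrightarrow> (\<forall>i. \<bar>y i - y' i\<bar> \<le> L \<theta>' * (\<theta>' - \<theta>)))
     \<and> (\<forall>\<theta> y. (\<theta>, y) \<in> g \<longrightarrow> (\<exists>d. P \<theta> y d \<and> (\<forall>\<^sub>F h in at_right 0. (\<theta> + h, move y h d) \<in> g)))}"
  have chain: "\<Union>C \<in> A" if C: "subset.chain A C" for C
  proof -
    have CA: "g \<in> A" if "g \<in> C" for g using C that by (auto simp: subset.chain_def)
    have join: "\<exists>k\<in>C. p \<in> k \<and> q \<in> k" if "g \<in> C" "h \<in> C" "p \<in> g" "q \<in> h" for g h p q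
      using C that unfolding subset.chain_def by blast
    show ?thesis unfolding A_def
    proof (intro CollectI conjI allI impI)
      fix \<theta> y assume "(\<theta>, y) \<in> \<Union>C"
      then obtain g where g: "g \<in> C" "(\<theta>, y) \<in> g" by blast
      note gA = CA[OF g(1), unfolded A_def]
      show "0 \<le> \<theta>" "J \<theta> y" using gA g(2) by blast+
      show "\<theta> = 0 \<Longrightarrow> y = y0" using gA g(2) by blast
      show "x \<in> fst ` \<Union>C" if "0 \<le> x" "x \<le> \<theta>" for x
      proof -
        have "x \<in> fst ` g" using gA g(2) that by blast
        with g(1) show ?thesis by blast
      qed
      obtain d where d: "P \<theta> y d" "\<forall>\<^sub>F h in at_right 0. (\<theta> + h, move y h d) \<in> g"
        using gA g(2) by blast
      from d(2) have "\<forall>\<^sub>F h in at_right 0. (\<theta> + h, move y h d) \<in> \<Union>C"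
        by (rule eventually_mono) (use g(1) in blast)
      with d(1) show "\<exists>d. P \<theta> y d \<and> (\<forall>\<^sub>F h in at_right 0. (\<theta> + h, move y h d) \<in> \<Union>C)" by blast
    next
      fix \<theta> y \<theta>' y' i assume *: "(\<theta>, y) \<in> \<Union>C" "(\<theta>', y') \<in> \<Union>C" "\<theta> \<le> \<theta>'"
      then obtain k where "k \<in> C" "(\<theta>, y) \<in> k" "(\<theta>', y') \<in> k" using join by (meson UnionE)
      with CA[unfolded A_def, of k] * show "\<bar>y i - y' i\<bar> \<le> L \<theta>' * (\<theta>' - \<theta>)" by blast
    qed
  qed
  obtain g where gA: "g \<in> A" and max: "\<And>k. k \<in> A \<Longrightarrow> g \<subseteq> k \<Longrightarrow> k = g"
    using subset_Zorn'[OF chain] by blast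
  have gJ: "0 \<le> \<theta>" "J \<theta> y" "\<theta> = 0 \<Longrightarrow> y = y0" if "(\<theta>, y) \<in> g" for \<theta> y
    using gA that unfolding A_def by blast+
  have gdown: "x \<in> fst ` g" if "(\<theta>, y) \<in> g" "0 \<le> x" "x \<le> \<theta>" for \<theta> y x
    using gA that unfolding A_def by blast
  have gLip: "\<bar>y i - y' i\<bar> \<le> L \<theta>' * (\<theta>' - \<theta>)" if "(\<theta>, y) \<in> g" "(\<theta>', y') \<in> g" "\<theta> \<le> \<theta>'" for \<theta> y \<theta>' y' i
    using gA that unfolding A_def by blast
  have gd: "\<exists>d. P \<theta> y d \<and> (\<forall>\<^sub>F h in at_right 0. (\<theta> + h, move y h d) \<in> g)" if "(\<theta>, y) \<in> g" for \<theta> y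
    using gA that unfolding A_def by blast
  have total: "\<theta> \<in> fst ` g" if \<theta>: "0 \<le> \<theta>" for \<theta>
  proof (rule ccontr)
    assume \<theta>_notin: "\<theta> \<notin> fst ` g"
    \<comment> \<open>The domain of \<open>g\<close> is the interval from 0 to \<open>c\<close>
      without \<open>c\<close>: it is downward closed, and it has no largest element because every
      state in \<open>g\<close> is continued to the right within \<open>g\<close>.\<close>
    define c where "c = Inf {x. 0 \<le> x \<and> x \<notin> fst ` g}"
    have ne: "{x. 0 \<le> x \<and> x \<notin> fst ` g} \<noteq> {}" using \<theta> \<theta>_notin by blast
    have bd: "bdd_below {x. 0 \<le> x \<and> x \<notin> fst ` g}" by (rule bdd_belowI[of _ 0]) blast
    have c0: "0 \<le> c" unfolding c_def by (rule cInf_greatest[OF ne]) blast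
    have below: "x \<in> fst ` g" if x: "0 \<le> x" "x < c" for x
      using x cInf_lower[OF _ bd, of x] unfolding c_def by force
    have above: "x \<notin> fst ` g" if x: "c < x" for x
    proof
      assume "x \<in> fst ` g"
      then obtain y where y: "(x, y) \<in> g" by auto
      have "x \<le> c" unfolding c_def
      proof (rule cInf_greatest[OF ne])
        fix z assume "z \<in> {x. 0 \<le> x \<and> x \<notin> fst ` g}"
        with gdown[OF y, of z] show "x \<le> z" by force
      qed
      with x show False by simp
    qed
    have c_notin: "c \<notin> fst ` g"
    proof
      assume "c \<in> fst ` g"
      then obtain y where "(c, y) \<in> g" by auto
      then obtain d where "\<forall>\<^sub>F h in at_right 0. (c + h, move y h d) \<in> g" using gd by blast
      then obtain e where "0 < e" "\<And>h. 0 < h \<Longrightarrow> h < e \<Longrightarrow> (c + h, move y h d) \<in> g"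
        by (auto simp: eventually_at_right_field)
      then have "(c + e / 2, move y (e/2) d) \<in> g" by simp
      with above[of "c + e/2"] \<open>0 < e\<close> show False by force
    qed
    have g_lt: "\<theta> < c" if "(\<theta>, y) \<in> g" for \<theta> y
    proof -
      have "\<theta> \<in> fst ` g" using that by force
      with above[of \<theta>] c_notin show ?thesis by (metis linorder_neqE_linordered_idom)
    qed
    have "\<exists>y. J c y \<and> (c = 0 \<longrightarrow> y = y0) \<and> (\<forall>\<theta> z i. (\<theta>, z) \<in> g \<longrightarrow> \<bar>z i - y i\<bar> \<le> L c * (c - \<theta>))"
    proof (cases "c = 0")
      \<comment> \<open>Here \<open>g\<close> is empty: the state has to be \<open>y0\<close>, and
        the Lipschitz clause is vacuous.\<close>
      case True
      with J0 g_lt gJ(1) show ?thesis by (metis not_le)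
    next
      case False
      with c0 have "0 < c" by simp
      define \<Theta> where "\<Theta> n = c - c / real (Suc n)" for n
      have \<Theta>: "0 \<le> \<Theta> n" "\<Theta> n < c" for n
      proof -
        have "c / real (Suc n) \<le> c / 1" using \<open>0 < c\<close> by (intro divide_left_mono) auto
        then show "0 \<le> \<Theta> n" by (simp add: \<Theta>_def)
        show "\<Theta> n < c" using \<open>0 < c\<close> by (simp add: \<Theta>_def)
      qed
      have lim: "\<Theta> \<longlonglongrightarrow> c"
        using tendsto_diff[OF tendsto_const LIMSEQ_Suc[OF lim_const_over_n[of c]], of c]
        unfolding \<Theta>_def by simp
      have "\<exists>y. (\<Theta> n, y) \<in> g" for n using below[OF \<Theta>] by force
      then obtain Y where Y: "\<And>n. (\<Theta> n, Y n) \<in> g" by metis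
      have lip: "\<bar>z i - z' i\<bar> \<le> L c * \<bar>\<theta>' - \<theta>\<bar>" if z: "(\<theta>, z) \<in> g" "(\<theta>', z') \<in> g" for \<theta> \<theta>' z z' i
      proof -
        have *: "\<bar>z i - z' i\<bar> \<le> L c * \<bar>\<theta>' - \<theta>\<bar>" if "(\<theta>, z) \<in> g" "(\<theta>', z') \<in> g" "\<theta> \<le> \<theta>'" for \<theta> \<theta>' z z'
        proof -
          have "L \<theta>' \<le> L c" using L[of \<theta>' c] gJ(1)[OF that(2)] g_lt[OF that(2)] by simp
          then have "L \<theta>' * (\<theta>' - \<theta>) \<le> L c * (\<theta>' - \<theta>)" using that(3) by (intro mult_right_mono) auto
          with gLip[OF that, of i] that(3) show ?thesis by simp
        qed
        show ?thesis
        proof (cases "\<theta> \<le> \<theta>'")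
          case True
          with *[OF z] show ?thesis by simp
        next
          case False
          with *[OF z(2,1)] show ?thesis by (simp add: abs_minus_commute)
        qed
      qed
      have Lc: "0 \<le> L c"
      proof -
        have "0 \<le> L c * \<bar>\<Theta> 1 - \<Theta> 0\<bar>" using lip[OF Y[of 0] Y[of 1], of undefined] by linarith
        moreover have "\<bar>\<Theta> 1 - \<Theta> 0\<bar> > 0" using \<open>0 < c\<close> by (simp add: \<Theta>_def)
        ultimately show ?thesis by (simp add: zero_le_mult_iff)
      qed
      have "Cauchy (\<lambda>n. Y n i)" for i
      proof (rule metric_CauchyI)
        fix e :: real assume "0 < e"
        then have "0 < e / (L c + 1)" using Lc by simp
        with LIMSEQ_imp_Cauchy[OF lim] obtain M where
          M: "\<And>m n. M \<le> m \<Longrightarrow> M \<le> n \<Longrightarrow> dist (\<Theta> m) (\<Theta> n) < e / (L c + 1)"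
          unfolding Cauchy_def by meson
        have "dist (Y m i) (Y n i) < e" if "M \<le> m" "M \<le> n" for m n
        proof -
          have "\<bar>Y m i - Y n i\<bar> \<le> L c * dist (\<Theta> m) (\<Theta> n)"
            using lip[OF Y[of m] Y[of n], of i] by (simp add: dist_real_def abs_minus_commute)
          also have "\<dots> \<le> (L c + 1) * dist (\<Theta> m) (\<Theta> n)" by (intro mult_right_mono) auto
          also have "\<dots> < e" using M[OF that] Lc by (simp add: pos_less_divide_eq mult.commute)
          finally show ?thesis by (simp add: dist_real_def)
        qed
        then show "\<exists>M. \<forall>m\<ge>M. \<forall>n\<ge>M. dist (Y m i) (Y n i) < e" by blast
      qed
      then have "\<exists>l. (\<lambda>n. Y n i) \<longlonglongrightarrow> l" for i
        using Cauchy_convergent_iff convergent_def by blast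
      then obtain y where y: "\<And>i. (\<lambda>n. Y n i) \<longlonglongrightarrow> y i" by metis
      have "J c y" by (rule closed[OF _ lim y]) (rule gJ(2)[OF Y])
      moreover have "\<bar>z i - y i\<bar> \<le> L c * (c - \<theta>)" if z: "(\<theta>, z) \<in> g" for \<theta> z i
      proof (rule LIMSEQ_le)
        show "(\<lambda>n. \<bar>z i - Y n i\<bar>) \<longlonglongrightarrow> \<bar>z i - y i\<bar>" by (intro tendsto_intros y)
        have "(\<lambda>n. L c * \<bar>\<Theta> n - \<theta>\<bar>) \<longlonglongrightarrow> L c * \<bar>c - \<theta>\<bar>" by (intro tendsto_intros lim)
        then show "(\<lambda>n. L c * \<bar>\<Theta> n - \<theta>\<bar>) \<longlonglongrightarrow> L c * (c - \<theta>)" using g_lt[OF z] by simp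
        show "\<exists>N. \<forall>n\<ge>N. \<bar>z i - Y n i\<bar> \<le> L c * \<bar>\<Theta> n - \<theta>\<bar>" using lip[OF z Y] by blast
      qed
      ultimately show ?thesis using False by blast
    qed
    then obtain y where y: "J c y" "c = 0 \<Longrightarrow> y = y0"
      "\<And>\<theta> z i. (\<theta>, z) \<in> g \<Longrightarrow> \<bar>z i - y i\<bar> \<le> L c * (c - \<theta>)" by blast
    obtain d e where d: "\<And>i. \<bar>d i\<bar> \<le> L c" "P c y d" and e: "0 < e"
      "\<And>h. 0 < h \<Longrightarrow> h < e \<Longrightarrow> J (c + h) (move y h d) \<and> P (c + h) (move y h d) d"
      using step[OF c0 y(1)] by (auto simp: eventually_at_right_field)
    have e0: "J (c + h) (move y h d) \<and> P (c + h) (move y h d) d" if "0 \<le> h" "h < e" for h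
      using e(2)[of h] y(1) d(2) that by (cases "h = 0") (auto simp: move_def)
    \<comment> \<open>The limit state and one linear phase from it are added. Since \<open>P\<close>
      holds with the same \<open>d\<close> along the whole phase, each added point has its
      continuation in \<open>k\<close>.\<close>
    define k where "k = g \<union> (\<lambda>h. (c + h, move y h d)) ` {0..<e}"
    have k_cases: thesis if "(\<theta>, z) \<in> k" "(\<theta>, z) \<in> g \<Longrightarrow> thesis"
      "\<And>h. 0 \<le> h \<Longrightarrow> h < e \<Longrightarrow> \<theta> = c + h \<Longrightarrow> z = move y h d \<Longrightarrow> thesis" for \<theta> z thesis
      using that unfolding k_def by auto
    have kI: "(c + h, move y h d) \<in> k" if "0 \<le> h" "h < e" for h using that unfolding k_def by auto
    have "k \<in> A" unfolding A_def
    proof (intro CollectI conjI allI impI)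
      fix \<theta> z assume z: "(\<theta>, z) \<in> k"
      show "0 \<le> \<theta>" using z by (rule k_cases) (use gJ c0 in auto)
      show "J \<theta> z" using z by (rule k_cases) (use gJ e0 in auto)
      show "z = y0" if "\<theta> = 0" using z
      proof (rule k_cases)
        fix h assume "0 \<le> h" "h < e" "\<theta> = c + h" "z = move y h d"
        with that c0 have "h = 0" "c = 0" by auto
        with y(2) \<open>z = move y h d\<close> show ?thesis by (simp add: move_def)
      qed (use gJ that in auto)
      show "x \<in> fst ` k" if x: "0 \<le> x" "x \<le> \<theta>" for x
      proof (cases "x < c")
        case True
        with below[OF x(1)] show ?thesis unfolding k_def by blast
      next
        case False
        from z have "x < c + e"
        proof (rule k_cases)
          assume "(\<theta>, z) \<in> g"
          with g_lt x e(1) show ?thesis by fastforce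
        qed (use x in auto)
        with False kI[of "x - c"] show ?thesis by force
      qed
      from z show "\<exists>d. P \<theta> z d \<and> (\<forall>\<^sub>F h in at_right 0. (\<theta> + h, move z h d) \<in> k)"
      proof (rule k_cases)
        assume "(\<theta>, z) \<in> g"
        from gd[OF this] obtain d' where d': "P \<theta> z d'" "\<forall>\<^sub>F h in at_right 0. (\<theta> + h, move z h d') \<in> g" by blast
        from d'(2) have "\<forall>\<^sub>F h in at_right 0. (\<theta> + h, move z h d') \<in> k"
          by (rule eventually_mono) (simp add: k_def)
        with d'(1) show ?thesis by blast
      next
        fix h assume h: "0 \<le> h" "h < e" "\<theta> = c + h" "z = move y h d"
        have "(\<theta> + l, move z l d) \<in> k" if "0 < l" "l < e - h" for l
        proof -
          have "move z l d = move y (h + l) d" unfolding h(4) move_def by (auto simp: algebra_simps)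
          with kI[of "h + l"] that h show ?thesis by (simp add: add.assoc)
        qed
        then have "\<forall>\<^sub>F l in at_right 0. (\<theta> + l, move z l d) \<in> k"
          unfolding eventually_at_right_field using h(2) by (intro exI[of _ "e - h"]) simp
        with e0[OF h(1,2)] h show ?thesis by blast
      qed
    next
      fix \<theta> z \<theta>' z' i assume z: "(\<theta>, z) \<in> k" "(\<theta>', z') \<in> k" and le: "\<theta> \<le> \<theta>'"
      from z(2) show "\<bar>z i - z' i\<bar> \<le> L \<theta>' * (\<theta>' - \<theta>)"
      proof (rule k_cases)
        assume z': "(\<theta>', z') \<in> g"
        from z(1) have "(\<theta>, z) \<in> g"
          by (rule k_cases) (use g_lt[OF z'] le in auto)
        with gLip z' le show ?thesis by blast
      next
        fix h' assume h': "0 \<le> h'" "h' < e" "\<theta>' = c + h'" "z' = move y h' d"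
        have LL: "L c \<le> L \<theta>'" using h' c0 by (intro L) auto
        from z(1) show ?thesis
        proof (rule k_cases)
          assume zg: "(\<theta>, z) \<in> g"
          have "\<bar>z i - z' i\<bar> \<le> \<bar>z i - y i\<bar> + \<bar>h' * d i\<bar>" unfolding h'(4) move_def by linarith
          also have "\<dots> \<le> L c * (c - \<theta>) + h' * L c"
            using y(3)[OF zg, of i] d(1)[of i] h'(1) by (auto simp: abs_mult intro!: add_mono mult_left_mono)
          also have "\<dots> = L c * (\<theta>' - \<theta>)" by (simp add: h'(3) algebra_simps)
          also have "\<dots> \<le> L \<theta>' * (\<theta>' - \<theta>)" using LL le by (intro mult_right_mono) auto
          finally show ?thesis .
        next
          fix h assume h: "0 \<le> h" "h < e" "\<theta> = c + h" "z = move y h d"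
          have "\<bar>z i - z' i\<bar> = (\<theta>' - \<theta>) * \<bar>d i\<bar>" unfolding h'(4) h(4) move_def
          proof -
            have "y i + h * d i - (y i + h' * d i) = - ((\<theta>' - \<theta>) * d i)"
              unfolding h(3) h'(3) by (simp add: algebra_simps)
            then show "\<bar>y i + h * d i - (y i + h' * d i)\<bar> = (\<theta>' - \<theta>) * \<bar>d i\<bar>"
              using le by (simp add: abs_mult)
          qed
          also have "\<dots> \<le> (\<theta>' - \<theta>) * L \<theta>'" using d(1)[of i] LL le by (intro mult_left_mono) auto
          finally show ?thesis by (simp add: mult.commute)
        qed
      qed
    qed
    from max[OF this] have "k = g" unfolding k_def by blast
    with kI[of 0] e(1) have "(c, move y 0 d) \<in> g" by simp
    with c_notin show False by force
  qed
  then have "\<exists>y. (\<theta>, y) \<in> g" if "0 \<le> \<theta>" for \<theta> using that by force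
  then obtain Y where Y: "\<And>\<theta>. 0 \<le> \<theta> \<Longrightarrow> (\<theta>, Y \<theta>) \<in> g" by metis
  have uniq: "y = Y \<theta>" if "(\<theta>, y) \<in> g" for \<theta> y
    using gLip[OF that Y[OF gJ(1)[OF that]]] by (intro ext) simp
  have "\<exists>d. P \<theta> (Y \<theta>) d \<and> (\<forall>\<^sub>F h in at_right 0. Y (\<theta> + h) = move (Y \<theta>) h d)" if \<theta>: "0 \<le> \<theta>" for \<theta>
  proof -
    obtain d where d: "P \<theta> (Y \<theta>) d" "\<forall>\<^sub>F h in at_right 0. (\<theta> + h, move (Y \<theta>) h d) \<in> g"
      using gd[OF Y[OF \<theta>]] by blast
    from d(2) have "\<forall>\<^sub>F h in at_right 0. Y (\<theta> + h) = move (Y \<theta>) h d"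
      by (rule eventually_mono) (rule uniq[symmetric])
    with d(1) show ?thesis by blast
  qed
  then obtain D where D: "\<And>\<theta>. 0 \<le> \<theta> \<Longrightarrow> P \<theta> (Y \<theta>) (D \<theta>)"
    "\<And>\<theta>. 0 \<le> \<theta> \<Longrightarrow> \<forall>\<^sub>F h in at_right 0. Y (\<theta> + h) = move (Y \<theta>) h (D \<theta>)" by metis
  show thesis
  proof (rule that[of Y D])
    show "Y 0 = y0" using gJ(3)[OF Y[of 0]] by simp
    show "J \<theta> (Y \<theta>) \<and> P \<theta> (Y \<theta>) (D \<theta>)" if "0 \<le> \<theta>" for \<theta> using gJ(2)[OF Y[OF that]] D(1)[OF that] by blast
    show "\<bar>Y \<theta> i - Y \<theta>' i\<bar> \<le> L \<theta>' * (\<theta>' - \<theta>)" if "0 \<le> \<theta>" "\<theta> \<le> \<theta>'" for \<theta> \<theta>' i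
      using gLip Y that by simp
    fix \<theta> :: real assume \<theta>: "0 \<le> \<theta>"
    obtain e where e: "0 < e" "\<And>h. 0 < h \<Longrightarrow> h < e \<Longrightarrow> Y (\<theta> + h) = move (Y \<theta>) h (D \<theta>)"
      using D(2)[OF \<theta>] by (auto simp: eventually_at_right_field)
    have "D (\<theta> + h) = D \<theta>" if h: "0 < h" "h < e" for h
    proof
      fix i
      obtain e' where e': "0 < e'" "\<And>l. 0 < l \<Longrightarrow> l < e' \<Longrightarrow> Y (\<theta> + h + l) = move (Y (\<theta> + h)) l (D (\<theta> + h))"
        using D(2)[of "\<theta> + h"] \<theta> h by (auto simp: eventually_at_right_field)
      \<comment> \<open>\<open>D\<close> was chosen separately at each time. For small
        \<open>l\<close> the phases chosen at \<open>\<theta>\<close> and at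
        \<open>\<theta> + h\<close> overlap, which forces their directions to agree.\<close>
      define l where "l = min (e' / 2) ((e - h) / 2)"
      have l: "0 < l" "l < e'" "h + l < e" using e'(1) h by (auto simp: l_def min_def field_simps)
      have "move (Y \<theta>) (h + l) (D \<theta>) = move (move (Y \<theta>) h (D \<theta>)) l (D (\<theta> + h))"
        using e(2)[of "h + l"] e(2)[of h] e'(2)[of l] l h by (simp add: add.assoc)
      from fun_cong[OF this, of i] have "l * D \<theta> i = l * D (\<theta> + h) i" by (simp add: move_def algebra_simps)
      with l(1) show "D (\<theta> + h) i = D \<theta> i" by simp
    qed
    with e show "\<forall>\<^sub>F h in at_right 0. Y (\<theta> + h) = move (Y \<theta>) h (D \<theta>) \<and> D (\<theta> + h) = D \<theta>"
      unfolding eventually_at_right_field by blast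
  qed
qed

section \<open>Continuous right-linear functions and their slopes\<close>

text \<open>Induction along an interval, the substitute for induction over pieces:
  \<open>left\<close> reaches the supremum of the points up to which \<open>P\<close> holds, and
  \<open>right\<close> passes beyond it unless it is \<open>b\<close>.\<close>

lemma real_interval_induct:
  fixes a b :: real
  assumes "a \<le> b" "P a"
    and right: "\<And>c. a \<le> c \<Longrightarrow> c < b \<Longrightarrow> P c \<Longrightarrow> \<forall>\<^sub>F h in at_right 0. P (c + h)"
    and left: "\<And>c. a < c \<Longrightarrow> c \<le> b \<Longrightarrow> (\<And>x. a \<le> x \<Longrightarrow> x < c \<Longrightarrow> P x) \<Longrightarrow> P c"
  shows "P b"
proof -
  define S where "S = {c \<in> {a..b}. \<forall>x\<in>{a..c}. P x}"
  have aS: "a \<in> S" using assms(1,2) by (auto simp: S_def)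
  have bd: "bdd_above S" by (rule bdd_aboveI[of _ b]) (auto simp: S_def)
  define c where "c = Sup S"
  have c: "a \<le> c" "c \<le> b"
  proof -
    show "a \<le> c" unfolding c_def by (rule cSup_upper[OF aS bd])
    show "c \<le> b" unfolding c_def by (rule cSup_least) (use aS in \<open>blast, simp add: S_def\<close>)
  qed
  have below: "P x" if x: "a \<le> x" "x < c" for x
  proof -
    obtain y where "y \<in> S" "x < y" using x(2) less_cSup_iff[of S x] aS bd unfolding c_def by blast
    with x show ?thesis by (auto simp: S_def)
  qed
  have Pc: "P c" using left[of c] below c assms(2) by (cases "a = c") (auto simp: less_le)
  have "c = b"
  proof (rule ccontr)
    assume "c \<noteq> b"
    with c have "c < b" by auto
    from right[OF c(1) this Pc] obtain e where e: "0 < e" "\<And>h. 0 < h \<Longrightarrow> h < e \<Longrightarrow> P (c + h)"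
      by (auto simp: eventually_at_right_field)
    define h where "h = min (e/2) (b - c)"
    have h: "0 < h" "h < e" "c + h \<le> b" using e \<open>c < b\<close> by (auto simp: h_def)
    have "P x" if "a \<le> x" "x \<le> c + h" for x
    proof (cases x c rule: linorder_cases)
      case greater
      then show ?thesis using e(2)[of "x - c"] that h by auto
    qed (use below Pc that in auto)
    then have "c + h \<in> S" using h c by (auto simp: S_def)
    from cSup_upper[OF this bd] h show False by (simp add: c_def)
  qed
  with Pc show ?thesis by simp
qed

text \<open>\<open>g\<close> is the right derivative of the continuous right-linear function
  \<open>G\<close>. It may be unbounded to the left of a point where pieces accumulate.\<close>

definition slopes :: "(real \<Rightarrow> real) \<Rightarrow> (real \<Rightarrow> real) \<Rightarrow> bool" where
  "slopes G g \<longleftrightarrow> (\<forall>x. isCont G x \<and> (\<forall>\<^sub>F h in at_right 0. G (x + h) = G x + h * g x \<and> g (x + h) = g x))"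

lemma slopesD: "slopes G g \<Longrightarrow> isCont G x"
  "slopes G g \<Longrightarrow> \<forall>\<^sub>F h in at_right 0. G (x + h) = G x + h * g x"
  "slopes G g \<Longrightarrow> \<forall>\<^sub>F h in at_right 0. g (x + h) = g x"
  by (auto simp: slopes_def elim: eventually_mono)

lemma eventually_at_right_0_obtain:
  assumes "\<forall>\<^sub>F h in at_right (0::real). P h"
  obtains e where "0 < e" "\<And>h. 0 < h \<Longrightarrow> h \<le> e \<Longrightarrow> P h"
proof -
  obtain e where "0 < e" "\<And>h. 0 < h \<Longrightarrow> h < e \<Longrightarrow> P h"
    using assms by (auto simp: eventually_at_right_field)
  then show thesis by (intro that[of "e/2"]) auto
qed

text \<open>The fundamental theorem by interval induction. Where pieces accumulate, nonnegativity of
  \<open>g\<close> turns the passage to the limit into monotone convergence.\<close>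

lemma slopes_has_integral:
  assumes G: "slopes G g" and nn: "\<And>x. 0 \<le> g x" and "a \<le> b"
  shows "(g has_integral G b - G a) {a..b}"
proof (rule real_interval_induct[where P = "\<lambda>c. (g has_integral G c - G a) {a..c}", OF \<open>a \<le> b\<close>])
  show "(g has_integral G a - G a) {a..a}"
    using has_integral_refl(1)[of g a] by simp
next
  fix c assume 3: "a \<le> c" "c < b" "(g has_integral G c - G a) {a..c}"
  obtain e where e: "0 < e" "\<And>h. 0 < h \<Longrightarrow> h \<le> e \<Longrightarrow> G (c + h) = G c + h * g c \<and> g (c + h) = g c"
    by (rule eventually_at_right_0_obtain[of "\<lambda>h. G (c + h) = G c + h * g c \<and> g (c + h) = g c"])
       (use G in \<open>auto simp: slopes_def\<close>)
  have "(g has_integral G (c + h) - G a) {a..c + h}" if h: "0 < h" "h \<le> e" for h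
  proof -
    have "((\<lambda>_. g c) has_integral h * g c) {c..c+h}"
      using has_integral_const_real[of "g c" c "c+h"] h by simp
    moreover have "g c = g x" if "x \<in> {c..c+h}" for x
      using e(2)[of "x - c"] that h by (cases "x = c") auto
    ultimately have "(g has_integral h * g c) {c..c+h}"
      by (rule has_integral_eq[rotated])
    from has_integral_combine[OF _ _ 3(3) this] 3 h e(2)[OF h] show ?thesis by (simp add: algebra_simps)
  qed
  then show "\<forall>\<^sub>F h in at_right 0. (g has_integral G (c + h) - G a) {a..c + h}"
    using e(1) unfolding eventually_at_right_field by (metis less_imp_le)
next
  fix c assume 4: "a < c" "c \<le> b" "\<And>x. a \<le> x \<Longrightarrow> x < c \<Longrightarrow> (g has_integral G x - G a) {a..x}"
  define X where "X k = c - (c - a) / real (Suc k)" for k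
  have X: "a \<le> X k" "X k < c" for k
  proof -
    have "(c - a) / real (Suc k) \<le> (c - a) / 1" using \<open>a < c\<close> by (intro divide_left_mono) auto
    then show "a \<le> X k" by (simp add: X_def)
    show "X k < c" using \<open>a < c\<close> by (simp add: X_def)
  qed
  have Xlim: "X \<longlonglongrightarrow> c"
    using tendsto_diff[OF tendsto_const LIMSEQ_Suc[OF lim_const_over_n[of "c - a"]], of c]
    unfolding X_def by simp
  have Xmono: "X k \<le> X (Suc k)" for k
    using \<open>a < c\<close> by (auto simp: X_def intro!: divide_left_mono)
  \<comment> \<open>All \<open>X k\<close> lie below \<open>c\<close>, so the truncations vanish at
    \<open>c\<close>; this one point is repaired at the end.\<close>
  have "((\<lambda>x. if x = c then 0 else g x) has_integral G c - G a) {a..c}"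
  proof (rule has_integral_monotone_convergence_increasing)
    show "((\<lambda>x. if x \<in> {a..X k} then g x else 0) has_integral G (X k) - G a) {a..c}" for k
      using 4(3)[of "X k"] X[of k] has_integral_restrict[of "{a..X k}" "{a..c}" g "G (X k) - G a"] by auto
    show "(if x \<in> {a..X k} then g x else 0) \<le> (if x \<in> {a..X (Suc k)} then g x else 0)" for k x
      using nn[of x] Xmono[of k] by auto
    show "(\<lambda>k. if x \<in> {a..X k} then g x else 0) \<longlonglongrightarrow> (if x = c then 0 else g x)" if "x \<in> {a..c}" for x
    proof (cases "x = c")
      case True
      have "\<not> c \<le> X k" for k using X(2)[of k] by simp
      with True show ?thesis by simp
    next
      case False
      then have "x < c" using that by auto
      with Xlim have "\<forall>\<^sub>F k in sequentially. x < X k" by (auto dest: order_tendstoD)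
      then have "\<forall>\<^sub>F k in sequentially. (if x \<in> {a..X k} then g x else 0) = g x"
        by eventually_elim (use that in auto)
      with False show ?thesis by (auto intro: tendsto_eventually)
    qed
    have "(\<lambda>k. G (X k)) \<longlonglongrightarrow> G c"
      using isCont_tendsto_compose[OF slopesD(1)[OF G] Xlim] .
    then show "(\<lambda>k. G (X k) - G a) \<longlonglongrightarrow> G c - G a" by (intro tendsto_intros)
  qed
  then show "(g has_integral G c - G a) {a..c}"
    by (rule has_integral_spike_finite[of "{c}", rotated 2]) auto
qed

text \<open>Only linearity on pieces and continuity enter, so the functions may have any sign.
  Taking \<open>k = 0\<close> gives constancy.\<close>

lemma slopes_eq_diff:
  assumes G: "slopes G g" and F: "slopes F f" and "a \<le> b"
    and eq: "\<And>x. a \<le> x \<Longrightarrow> x < b \<Longrightarrow> g x = k * f x"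
  shows "G b - G a = k * (F b - F a)"
proof (rule real_interval_induct[where P = "\<lambda>c. G c - G a = k * (F c - F a)", OF \<open>a \<le> b\<close>])
  fix c assume 3: "a \<le> c" "c < b" "G c - G a = k * (F c - F a)"
  have "\<forall>\<^sub>F h in at_right 0. G (c + h) = G c + h * g c" "\<forall>\<^sub>F h in at_right 0. F (c + h) = F c + h * f c"
    "\<forall>\<^sub>F h in at_right 0. h < b - c"
    using slopesD(2)[OF G] slopesD(2)[OF F] 3 by (auto simp: eventually_at_right_field intro: exI[of _ "b - c"])
  then show "\<forall>\<^sub>F h in at_right 0. G (c + h) - G a = k * (F (c + h) - F a)"
  proof eventually_elim
    case (elim h)
    then show ?case using 3 eq[of c] by (simp add: algebra_simps)
  qed
next
  fix c assume 4: "a < c" "c \<le> b" "\<And>x. a \<le> x \<Longrightarrow> x < c \<Longrightarrow> G x - G a = k * (F x - F a)"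
  have "((\<lambda>x. G x - k * F x) \<longlongrightarrow> G c - k * F c) (at_left c)"
    using slopesD(1)[OF G, of c] slopesD(1)[OF F, of c]
    by (intro tendsto_intros) (auto simp: isCont_def filterlim_at_split)
  moreover have "\<forall>\<^sub>F x in at_left c. G x - k * F x = G a - k * F a"
    using \<open>a < c\<close> 4(3) unfolding eventually_at_left_field
    by (intro exI[of _ a]) (auto simp: algebra_simps)
  then have "((\<lambda>x. G x - k * F x) \<longlongrightarrow> G a - k * F a) (at_left c)"
    by (rule tendsto_eventually)
  ultimately have "G c - k * F c = G a - k * F a"
    by (rule tendsto_unique[rotated]) simp
  then show "G c - G a = k * (F c - F a)" by (simp add: algebra_simps)
qed simp

lemma slopes_mono:
  assumes G: "slopes G g" and nn: "\<And>x. 0 \<le> g x" shows "mono G"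
proof
  fix a b :: real assume "a \<le> b"
  from has_integral_nonneg[OF slopes_has_integral[OF G nn this]] nn show "G a \<le> G b" by simp
qed

lemma slopes_linear_piece:
  assumes "slopes G g"
  shows "\<exists>e>0. \<forall>h. 0 < h \<longrightarrow> h \<le> e \<longrightarrow> G (x + h) = G x + h * g x \<and> g (x + h) = g x"
proof -
  have "\<forall>\<^sub>F h in at_right 0. G (x + h) = G x + h * g x \<and> g (x + h) = g x"
    using assms by (simp add: slopes_def)
  from eventually_at_right_0_obtain[OF this] show ?thesis by metis
qed

lemma slopes_right_constant: "slopes G g \<Longrightarrow> right_constant g"
  unfolding right_constant_def
proof
  fix \<theta> assume "slopes G g"
  then obtain e where e: "0 < e" "\<And>h. 0 < h \<Longrightarrow> h \<le> e \<Longrightarrow> g (\<theta> + h) = g \<theta>"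
    using slopes_linear_piece[of G g \<theta>] by blast
  have "g y = g \<theta>" if "y \<in> {\<theta>..<\<theta> + e}" for y
    using e(2)[of "y - \<theta>"] that by (cases "y = \<theta>") auto
  with e(1) show "\<exists>e>0. g constant_on {\<theta>..<\<theta> + e}" unfolding constant_on_def by blast
qed

lemma slopes_right_linear: "slopes G g \<Longrightarrow> right_linear G"
  unfolding right_linear_def
proof
  fix \<theta> assume "slopes G g"
  then obtain e where e: "0 < e" "\<And>h. 0 < h \<Longrightarrow> h \<le> e \<Longrightarrow> G (\<theta> + h) = G \<theta> + h * g \<theta>"
    using slopes_linear_piece[of G g \<theta>] by blast
  have "G y = g \<theta> * y + (G \<theta> - \<theta> * g \<theta>)" if "y \<in> {\<theta>..<\<theta> + e}" for y
    using e(2)[of "y - \<theta>"] that by (cases "y = \<theta>") (auto simp: algebra_simps)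
  with e(1) show "\<exists>e>0. \<exists>a b. \<forall>y\<in>{\<theta>..<\<theta> + e}. G y = a * y + b" by blast
qed

section \<open>Cumulative rates, up to countable sets\<close>

lemma countable_null_sets_lebesgue: "countable (N :: real set) \<Longrightarrow> N \<in> null_sets lebesgue"
  by (simp add: countable_imp_null_set_lborel null_sets_completionI)

lemma AE_lebesgue_off_countable:
  fixes N :: "real set"
  assumes "countable N" "\<And>x. x \<notin> N \<Longrightarrow> P x"
  shows "AE x in lebesgue. P x"
  by (rule AE_I'[OF countable_null_sets_lebesgue[OF assms(1)]]) (use assms(2) in blast)

text \<open>The deviation on a countable set is allowed because inflow rates will be set to 0 at
  exceptional times.\<close>

lemma slopes_cumulative:
  assumes G: "slopes G g0" "\<And>x. 0 \<le> g0 x" and g: "\<And>x. 0 \<le> g x" "countable N" "\<And>x. x \<notin> N \<Longrightarrow> g x = g0 x"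
    and G0: "\<And>x. x \<le> 0 \<Longrightarrow> G x = 0"
  shows "g absolutely_integrable_on {a..b}" and "cumulative g \<theta> = G \<theta>"
proof -
  have "negligible N" using countable_null_sets_lebesgue[OF g(2)] by (simp add: negligible_iff_null_sets)
  have int: "(g has_integral G b - G a) {a..b}" if "a \<le> b" for a b
    by (rule has_integral_spike[OF \<open>negligible N\<close> _ slopes_has_integral[OF G that]]) (use g(3) in auto)
  have abs: "g absolutely_integrable_on {a..b}" for a b
    using int[of a b] g(1) by (cases "a \<le> b") (auto intro!: nonnegative_absolutely_integrable_1 simp: has_integral_integrable)
  show "g absolutely_integrable_on {a..b}" by (rule abs)
  \<comment> \<open>The interval integral in \<open>cumulative\<close> is taken over an open
    interval, with reversed sign if \<open>\<theta> < 0\<close>.\<close>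
  have open_int: "(LINT x:{a<..<b}|lebesgue. g x) = G b - G a" if "a \<le> b" for a b
  proof -
    have "set_integrable lebesgue {a<..<b} g"
      by (rule set_integrable_subset[OF abs[of a b]]) auto
    then have "(LINT x:{a<..<b}|lebesgue. g x) = integral {a<..<b} g" by (rule set_lebesgue_integral_eq_integral)
    also have "\<dots> = G b - G a" using int[OF that] integral_open_interval_real[of a b g] by (simp add: integral_unique)
    finally show ?thesis .
  qed
  show "cumulative g \<theta> = G \<theta>"
  proof (cases "0 \<le> \<theta>")
    case True
    then have "einterval 0 (ereal \<theta>) = {0<..<\<theta>}" by (auto simp: einterval_def zero_ereal_def)
    with True open_int[OF True] G0[of 0] show ?thesis
      by (simp add: cumulative_def interval_lebesgue_integral_def)
  next
    case False
    then have "einterval (ereal \<theta>) 0 = {\<theta><..<0}" by (auto simp: einterval_def zero_ereal_def)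
    with False open_int[of \<theta> 0] G0[of 0] G0[of \<theta>] show ?thesis
      by (simp add: cumulative_def interval_lebesgue_integral_def)
  qed
qed

section \<open>Thin flows with resetting\<close>

lemma step_function_regular:
  fixes u :: "real \<Rightarrow> real" and \<xi> :: "nat \<Rightarrow> real"
  assumes "incseq \<xi>" "\<xi> 0 = 0" "filterlim \<xi> at_top sequentially"
    and const: "\<And>k. u constant_on {\<xi> k..<\<xi> (Suc k)}" and neg: "\<And>\<theta>. \<theta> < 0 \<Longrightarrow> u \<theta> = 0"
  shows "\<forall>\<^sub>F h in at_right 0. u (\<theta> + h) = u \<theta>" and "bdd_above (u ` {0..\<theta>})"
proof -
  have ex: "\<exists>n. \<theta> < \<xi> n" for \<theta>
    using assms(3) by (auto simp: filterlim_at_top_dense eventually_sequentially)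
  show "\<forall>\<^sub>F h in at_right 0. u (\<theta> + h) = u \<theta>"
  proof (cases "\<theta> < 0")
    case True
    then show ?thesis unfolding eventually_at_right_field
      by (intro exI[of _ "- \<theta>"]) (auto simp: neg)
  next
    case False
    \<comment> \<open>Consecutive breakpoints may coincide; the least index beyond
      \<open>\<theta>\<close> selects the piece containing \<open>\<theta>\<close>.\<close>
    define n where "n = (LEAST n. \<theta> < \<xi> n)"
    have n: "\<theta> < \<xi> n" unfolding n_def by (rule LeastI_ex[OF ex])
    then have "n \<noteq> 0" using False assms(2) by (metis)
    then obtain k where k: "n = Suc k" by (cases n) auto
    have "\<not> \<theta> < \<xi> k" using not_less_Least[of k "\<lambda>n. \<theta> < \<xi> n"] k by (simp add: n_def[symmetric])
    then have mem: "\<theta> \<in> {\<xi> k..<\<xi> (Suc k)}" using n k by simp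
    obtain c where c: "\<And>x. x \<in> {\<xi> k..<\<xi> (Suc k)} \<Longrightarrow> u x = c" using const[of k] by (auto simp: constant_on_def)
    have "u (\<theta> + h) = u \<theta>" if "0 < h" "h < \<xi> (Suc k) - \<theta>" for h
      using c[of "\<theta> + h"] c[OF mem] that mem by auto
    then show ?thesis unfolding eventually_at_right_field
      using mem by (intro exI[of _ "\<xi> (Suc k) - \<theta>"]) auto
  qed
  have "bdd_above (u ` {0..<\<xi> n})" for n
  proof (induction n)
    case (Suc n)
    obtain c where c: "\<And>x. x \<in> {\<xi> n..<\<xi> (Suc n)} \<Longrightarrow> u x = c" using const[of n] by (auto simp: constant_on_def)
    have "u ` {0..<\<xi> (Suc n)} \<subseteq> u ` {0..<\<xi> n} \<union> {c}"
    proof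
      fix y assume "y \<in> u ` {0..<\<xi> (Suc n)}"
      then obtain a where "y = u a" "0 \<le> a" "a < \<xi> (Suc n)" by auto
      then show "y \<in> u ` {0..<\<xi> n} \<union> {c}" using c[of a] by (cases "a < \<xi> n") auto
    qed
    then show ?case by (rule bdd_above_mono[rotated]) (simp add: Suc)
  qed (simp add: assms(2))
  moreover obtain n where "\<theta> < \<xi> n" using ex by blast
  ultimately show "bdd_above (u ` {0..\<theta>})"
    by (meson bdd_above_mono image_mono atLeastatMost_subset_iff subset_iff atLeastAtMost_iff atLeastLessThan_iff order_le_less_trans)
qed

context network
begin

text \<open>
  For the earliest times \<open>l\<close> of an equilibrium, \<open>tight l\<close> is the set of active arcs, and the
  active arcs with strict inequality are those with a nonempty queue. Only on the latter does
  \<open>slope_bound\<close> ignore the speed \<open>a\<close> of the tail (resetting).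
\<close>

definition tight :: "('a \<Rightarrow> real) \<Rightarrow> 'b set" where
  "tight l = {e \<in> arcs G. l (tail G e) + \<tau> e \<le> l (head G e)}"

definition slope_bound :: "('a \<Rightarrow> real) \<Rightarrow> 'b \<Rightarrow> real \<Rightarrow> real \<Rightarrow> real" where
  "slope_bound l e a y = (if l (tail G e) + \<tau> e < l (head G e) then y / \<nu> e else max a (y / \<nu> e))"

text \<open>Dominates 1, the speed of the source, and every \<open>u0 / \<nu> e\<close>, the speed
  at which a flow of \<open>u0\<close> moves the head of a queueing arc.\<close>

definition speed_bound :: "real \<Rightarrow> real" where
  "speed_bound u0 = 1 + u0 * (\<Sum>e\<in>arcs G. 1 / \<nu> e)"

text \<open>
  The sink absorbs exactly the inflow of the source, although feasibility does not demand it.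
\<close>

definition thin_flow :: "('a \<Rightarrow> real) \<Rightarrow> real \<Rightarrow> ('a \<Rightarrow> real) \<Rightarrow> ('b \<Rightarrow> real) \<Rightarrow> bool" where
  "thin_flow l u0 d x \<longleftrightarrow> d s = 1 \<and> (\<forall>v. v \<notin> verts G \<longrightarrow> d v = 0)
     \<and> (\<forall>v. 0 \<le> d v \<and> d v \<le> speed_bound u0)
     \<and> (\<forall>e. 0 \<le> x e \<and> x e \<le> u0) \<and> (\<forall>e. e \<notin> tight l \<longrightarrow> x e = 0)
     \<and> (\<forall>e\<in>tight l. d (head G e) \<le> slope_bound l e (d (tail G e)) (x e))
     \<and> (\<forall>e\<in>tight l. 0 < x e \<longrightarrow> d (head G e) = slope_bound l e (d (tail G e)) (x e))
     \<and> (\<forall>w\<in>verts G - {s}. \<exists>e\<in>tight l. head G e = w \<and> d w = slope_bound l e (d (tail G e)) (x e))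
     \<and> (\<forall>v\<in>verts G. (\<Sum>e\<in>out_arcs G v. x e) - (\<Sum>e\<in>in_arcs G v. x e)
           = (if v = s then u0 else if v = t then - u0 else 0))"

section \<open>Acyclicity of the tight arcs\<close>

definition tight_spanning :: "('a \<Rightarrow> real) \<Rightarrow> bool" where
  "tight_spanning l \<longleftrightarrow> (\<forall>w\<in>verts G - {s}. \<exists>e\<in>tight l. head G e = w)"

definition tight_rel :: "('a \<Rightarrow> real) \<Rightarrow> ('a \<times> 'a) set" where
  "tight_rel l = (\<lambda>e. (tail G e, head G e)) ` tight l"

lemma tight_arcs: "e \<in> tight l \<Longrightarrow> e \<in> arcs G" by (simp add: tight_def)

lemma finite_tight: "finite (tight l)"
  by (rule finite_subset[OF _ finite_arcs]) (auto simp: tight_def)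

text \<open>Along a tight arc the label grows by at least the travel time, so a tight cycle would
  have total travel time at most 0.\<close>

lemma wf_tight_rel: "wf (tight_rel l)"
proof (rule finite_acyclic_wf)
  show "finite (tight_rel l)" by (simp add: tight_rel_def finite_tight)
  \<comment> \<open>The tight arcs as a subgraph, which gives access to walks and cycles;
    \<open>tel\<close> adds up the tightness inequalities along a walk.\<close>
  define H where "H = G\<lparr>arcs := tight l\<rparr>"
  have H: "arcs H = tight l" "verts H = verts G" "tail H = tail G" "head H = head G"
    by (auto simp: H_def)
  interpret H: wf_digraph H
    by unfold_locales (auto simp: H tight_def)
  have sub: "subgraph H G"
    by (rule subgraphI) (auto simp: H tight_def compatible_def wf_digraph_axioms H.wf_digraph_axioms)
  have rel: "arcs_ends H = tight_rel l"
    by (auto simp: arcs_ends_def arc_to_ends_def tight_rel_def H)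
  have tel: "l u + sum_list (map \<tau> p) \<le> l v" if "H.awalk u p v" for u p v
    using that by (induction p arbitrary: u) (fastforce simp: H.awalk_simps H tight_def)+
  show "acyclic (tight_rel l)" unfolding acyclic_def
  proof (intro allI notI)
    fix v assume "(v, v) \<in> (tight_rel l)\<^sup>+"
    then obtain p where "H.awalk v p v" "p \<noteq> []" by (auto simp: rel[symmetric] H.reachable1_awalk)
    then have "H.closed_w p" by (auto simp: H.closed_w_def)
    then obtain c where c: "H.cycle c" using H.closed_w_imp_cycle by blast
    then have pos: "0 < (\<Sum>e\<in>set c. \<tau> e)" using subgraph_cycle[OF sub] cycle_travel_time_pos by blast
    obtain u where "H.awalk u c u" "distinct c" using c by (auto simp: H.cycle_conv)
    with tel[of u c u] have "(\<Sum>e\<in>set c. \<tau> e) \<le> 0" by (simp add: sum_list_distinct_conv_sum_set)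
    with pos show False by simp
  qed
qed

lemma tight_relI: "e \<in> tight l \<Longrightarrow> (tail G e, head G e) \<in> tight_rel l"
  by (auto simp: tight_rel_def)

text \<open>Going back along tight arcs must stop, and only \<open>s\<close> may lack an entering
  one.\<close>

lemma source_tight_reaches:
  assumes "tight_spanning l" "v \<in> verts G"
  shows "(s, v) \<in> (tight_rel l)\<^sup>*"
  using assms(2)
proof (induction v rule: wf_induct_rule[OF wf_tight_rel[of l]])
  case (1 v)
  show ?case
  proof (cases "v = s")
    case False
    then obtain e where e: "e \<in> tight l" "head G e = v" using assms(1) 1(2) by (auto simp: tight_spanning_def)
    then have "(tail G e, v) \<in> tight_rel l" using tight_relI by force
    moreover have "tail G e \<in> verts G" using e tight_arcs by auto
    ultimately show ?thesis using 1(1) by (meson rtrancl.rtrancl_into_rtrancl)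
  qed simp
qed

text \<open>The tail is reached from \<open>s\<close> by tight arcs, so a tight arc into
  \<open>s\<close> would close a tight cycle.\<close>

lemma head_tight_neq_source:
  assumes "tight_spanning l" "e \<in> tight l" shows "head G e \<noteq> s"
proof
  assume "head G e = s"
  then have "(tail G e, s) \<in> tight_rel l" using tight_relI[OF assms(2)] by simp
  moreover have "(s, tail G e) \<in> (tight_rel l)\<^sup>*"
    using source_tight_reaches[OF assms(1)] tight_arcs[OF assms(2)] by auto
  ultimately have "(s, s) \<in> (tight_rel l)\<^sup>+" by (rule rtrancl_into_trancl1[rotated])
  with wf_acyclic[OF wf_tight_rel[of l]] show False by (auto simp: acyclic_def)
qed

lemma tight_spanning_ge_source:
  assumes "tight_spanning l" "v \<in> verts G" shows "l s \<le> l v"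
  using source_tight_reaches[OF assms]
proof (induction rule: rtrancl_induct)
  case (step y z)
  then obtain e where "e \<in> tight l" "tail G e = y" "head G e = z" by (auto simp: tight_rel_def)
  with step.IH travel_time_nonneg[of e] show ?case by (auto simp: tight_def)
qed simp

lemma sum_arcs_by_vertex:
  assumes "D \<subseteq> verts G"
  shows "(\<Sum>v\<in>D. \<Sum>e\<in>in_arcs G v. f e) = (\<Sum>e | e \<in> arcs G \<and> head G e \<in> D. f e)"
    and "(\<Sum>v\<in>D. \<Sum>e\<in>out_arcs G v. f e) = (\<Sum>e | e \<in> arcs G \<and> tail G e \<in> D. f e)"
proof -
  have fin: "finite D" using assms finite_verts finite_subset by blast
  have "(\<Sum>e | e \<in> arcs G \<and> h e \<in> D. f e) = (\<Sum>v\<in>D. \<Sum>e | e \<in> arcs G \<and> h e = v. f e)"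
    for h :: "'b \<Rightarrow> 'a"
  proof -
    have "(\<Sum>v\<in>D. sum f {e \<in> {e. e \<in> arcs G \<and> h e \<in> D}. h e = v}) = sum f {e. e \<in> arcs G \<and> h e \<in> D}"
      by (rule sum.group) (use fin in auto)
    moreover have "{e \<in> {e. e \<in> arcs G \<and> h e \<in> D}. h e = v} = {e. e \<in> arcs G \<and> h e = v}" if "v \<in> D" for v
      using that by auto
    ultimately show ?thesis by (simp cong: sum.cong)
  qed
  from this[of "head G"] this[of "tail G"]
  show "(\<Sum>v\<in>D. \<Sum>e\<in>in_arcs G v. f e) = (\<Sum>e | e \<in> arcs G \<and> head G e \<in> D. f e)"
    and "(\<Sum>v\<in>D. \<Sum>e\<in>out_arcs G v. f e) = (\<Sum>e | e \<in> arcs G \<and> tail G e \<in> D. f e)"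
    by (simp_all add: in_arcs_def out_arcs_def)
qed

section \<open>Existence and persistence of thin flows\<close>

lemma slope_bound_mono: "a \<le> b \<Longrightarrow> slope_bound l e a y \<le> slope_bound l e b y"
  by (auto simp: slope_bound_def)

lemma slope_bound_ge: "y / \<nu> e \<le> slope_bound l e a y"
  by (auto simp: slope_bound_def)

text \<open>The upper bounds of the box are artificial and have to be shown inactive in the right
  order: the inequality \<open>netin_le\<close> alone gives \<open>x e \<le> u0\<close>, this keeps
  the labels below their cap, and only then does conservation hold with equality.\<close>

lemma thin_flow_exists:
  assumes span: "tight_spanning l" and u0: "0 \<le> u0"
  obtains d x where "thin_flow l u0 d x"
proof -
  \<comment> \<open>The labels \<open>lam\<close> are prices: a vertex with positive label must not receive more net inflow
    than it demands, an arc must not carry flow if its slope bound exceeds the label of its head.\<close>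
  define Lb where "Lb = 1 + speed_bound u0"
  define V where "V = verts G - {s}"
  define I where "I = Inl ` V \<union> Inr ` tight l"
  \<comment> \<open>\<open>Lb\<close> exceeds every speed that a flow of at most \<open>u0\<close>
    can cause. An arc filled to its cap would have a slope bound above \<open>Lb\<close>, hence
    above the label of its head, against complementarity.\<close>
  define m where "m = case_sum (\<lambda>_::'a. Lb) (\<lambda>e. Lb * \<nu> e + 1)"
  define lam where "lam z v = (if v = s then 1 else z (Inl v))" for z :: "'a + 'b \<Rightarrow> real" and v
  define netin where "netin z w = (\<Sum>e\<in>in_arcs G w. z (Inr e)) - (\<Sum>e\<in>out_arcs G w. z (Inr e))"
    for z :: "'a + 'b \<Rightarrow> real" and w
  define b where "b w = (if w = t then u0 else 0)" for w
  define F where "F z = case_sum (\<lambda>w. netin z w - b w)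
     (\<lambda>e. slope_bound l e (lam z (tail G e)) (z (Inr e)) - lam z (head G e))" for z
  have ratio: "u0 / \<nu> e \<le> speed_bound u0 - 1" if "e \<in> arcs G" for e
  proof -
    have "1 / \<nu> e \<le> (\<Sum>e\<in>arcs G. 1 / \<nu> e)"
      by (rule member_le_sum[OF that]) (use service_rate_pos in \<open>auto simp: less_imp_le\<close>)
    from mult_left_mono[OF this u0] show ?thesis by (simp add: speed_bound_def)
  qed
  have sb1: "1 \<le> speed_bound u0" unfolding speed_bound_def using u0 service_rate_pos
    by (auto intro!: mult_nonneg_nonneg sum_nonneg simp: less_imp_le)
  then have Lb: "2 \<le> Lb" by (simp add: Lb_def)
  have \<nu>: "0 < \<nu> e" if "e \<in> tight l" for e using tight_arcs[OF that] service_rate_pos by simp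
  have fin: "finite I" by (simp add: I_def V_def finite_tight)
  have mpos: "0 < m i" if "i \<in> I" for i
    using that Lb \<nu> unfolding I_def m_def by (auto intro!: add_nonneg_pos mult_nonneg_nonneg simp: less_imp_le)
  obtain z where z0: "\<And>i. i \<notin> I \<Longrightarrow> z i = 0" and zm: "\<And>i. i \<in> I \<Longrightarrow> 0 \<le> z i \<and> z i \<le> m i"
    and zF: "\<And>i. i \<in> I \<Longrightarrow> z i < m i \<Longrightarrow> 0 \<le> F z i" "\<And>i. i \<in> I \<Longrightarrow> 0 < z i \<Longrightarrow> F z i \<le> 0"
  proof (rule box_complementarity[where F = F and m = m, OF fin mpos])
    fix Z z i assume Z: "\<And>j :: 'a + 'b. (\<lambda>k. Z k j) \<longlonglongrightarrow> (z j :: real)" and "i \<in> I"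
    have lam: "(\<lambda>k. lam (Z k) v) \<longlonglongrightarrow> lam z v" for v
      unfolding lam_def by (cases "v = s") (simp_all add: Z)
    show "(\<lambda>k. F (Z k) i) \<longlonglongrightarrow> F z i"
    proof (cases i)
      case (Inl w)
      then show ?thesis by (auto simp: F_def netin_def intro!: tendsto_intros Z)
    next
      case (Inr e)
      with \<open>i \<in> I\<close> have "\<nu> e \<noteq> 0" using \<nu>[of e] by (auto simp: I_def)
      \<comment> \<open>The case distinction in \<open>slope_bound\<close> depends on
        \<open>l\<close> alone, so each case is continuous in \<open>z\<close>.\<close>
      with Inr show ?thesis by (auto simp: F_def slope_bound_def intro!: tendsto_intros Z lam)
    qed
  qed (assumption, rule that)
  define x where "x e = z (Inr e)" for e
  have x_nn: "0 \<le> x e" for e using z0[of "Inr e"] zm[of "Inr e"] by (cases "Inr e \<in> I") (auto simp: x_def)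
  have x_0: "x e = 0" if "e \<notin> tight l" for e using that z0[of "Inr e"] by (auto simp: x_def I_def)
  have lam_nn: "0 \<le> lam z v" for v
    using z0[of "Inl v"] zm[of "Inl v"] by (cases "Inl v \<in> I") (auto simp: lam_def)
  have lam_le: "lam z v \<le> Lb" for v
    using z0[of "Inl v"] zm[of "Inl v"] Lb by (cases "Inl v \<in> I") (auto simp: lam_def m_def)
  have netin: "netin z w = (\<Sum>e\<in>in_arcs G w. x e) - (\<Sum>e\<in>out_arcs G w. x e)" for w
    by (simp add: netin_def x_def)
  have arc: "lam z (head G e) \<le> slope_bound l e (lam z (tail G e)) (x e)"
    "0 < x e \<Longrightarrow> lam z (head G e) = slope_bound l e (lam z (tail G e)) (x e)" if e: "e \<in> tight l" for e
  proof -
    have eI: "Inr e \<in> I" using e by (simp add: I_def)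
    have "x e < Lb * \<nu> e + 1"
    proof (rule ccontr)
      assume *: "\<not> x e < Lb * \<nu> e + 1"
      moreover have "0 < Lb * \<nu> e" using Lb \<nu>[OF e] by simp
      ultimately have "F z (Inr e) \<le> 0" using zF(2)[OF eI] by (simp add: x_def)
      then have "x e / \<nu> e \<le> Lb"
        using slope_bound_ge[of "x e" e l "lam z (tail G e)"] lam_le[of "head G e"] by (simp add: F_def x_def)
      with * \<nu>[OF e] show False by (simp add: divide_le_eq)
    qed
    then have "0 \<le> F z (Inr e)" using zF(1)[OF eI] by (simp add: x_def m_def)
    then show *: "lam z (head G e) \<le> slope_bound l e (lam z (tail G e)) (x e)" by (simp add: F_def x_def)
    assume "0 < x e"
    then show "lam z (head G e) = slope_bound l e (lam z (tail G e)) (x e)"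
      using zF(2)[OF eI] * by (simp add: F_def x_def)
  qed
  have netin_le: "netin z w \<le> b w" if w: "w \<in> V" for w
  proof (cases "0 < z (Inl w)")
    case True
    then show ?thesis using zF(2)[of "Inl w"] w by (simp add: I_def F_def)
  next
    case False
    \<comment> \<open>Flow on \<open>e\<close> would force the label of \<open>w\<close> to be at
      least \<open>x e / \<nu> e\<close>, but this label is 0.\<close>
    have "x e = 0" if e: "e \<in> in_arcs G w" for e
    proof (rule ccontr)
      assume "x e \<noteq> 0"
      then have pos: "0 < x e" and t: "e \<in> tight l" using x_nn[of e] x_0[of e] by (auto simp: less_le)
      have "lam z w = 0" using False lam_nn[of w] w by (simp add: lam_def V_def)
      then have "x e / \<nu> e \<le> 0" using arc(2)[OF t pos] slope_bound_ge[of "x e" e l "lam z (tail G e)"] e by simp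
      with pos \<nu>[OF t] show False by (simp add: divide_le_0_iff)
    qed
    then have "netin z w \<le> 0" unfolding netin using x_nn by (simp add: sum_nonneg)
    then show ?thesis using u0 by (auto simp: b_def)
  qed
  have x_le: "x e \<le> u0" for e
  proof (cases "e \<in> tight l")
    case e: True
    \<comment> \<open>No flow leaves the set of vertices downstream of \<open>e\<close>, which demands at most \<open>u0\<close> in total.\<close>
    define D where "D = {y \<in> verts G. (head G e, y) \<in> (tight_rel l)\<^sup>*}"
    have acyc: "(v, v) \<notin> (tight_rel l)\<^sup>+" for v
      using wf_acyclic[OF wf_tight_rel[of l]] by (auto simp: acyclic_def)
    have tail_D: "tail G e \<notin> D"
    proof
      assume "tail G e \<in> D"
      then have "(head G e, tail G e) \<in> (tight_rel l)\<^sup>*" by (simp add: D_def)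
      with tight_relI[OF e] have "(head G e, head G e) \<in> (tight_rel l)\<^sup>+" by (rule rtrancl_into_trancl1[rotated -1])
      with acyc show False by blast
    qed
    have s_D: "s \<notin> D"
    proof
      assume "s \<in> D"
      then have "(head G e, s) \<in> (tight_rel l)\<^sup>*" by (simp add: D_def)
      moreover have "(s, tail G e) \<in> (tight_rel l)\<^sup>*"
        using source_tight_reaches[OF span] tight_arcs[OF e] by auto
      ultimately have "(head G e, head G e) \<in> (tight_rel l)\<^sup>+"
        using tight_relI[OF e] by (meson rtrancl_into_trancl1 rtrancl_trans)
      with acyc show False by blast
    qed
    have "D \<subseteq> verts G" by (auto simp: D_def)
    \<comment> \<open>Arcs with flow that start in \<open>D\<close> end in \<open>D\<close>, and so
      does \<open>e\<close>, whose tail lies outside. Therefore the net inflow of \<open>D\<close>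
      is at least \<open>x e\<close>.\<close>
    have "x e + (\<Sum>e | e \<in> arcs G \<and> tail G e \<in> D. x e) = (\<Sum>e\<in>insert e {e \<in> arcs G. tail G e \<in> D \<and> e \<in> tight l}. x e)"
    proof -
      have "(\<Sum>e | e \<in> arcs G \<and> tail G e \<in> D. x e) = (\<Sum>e\<in>{e \<in> arcs G. tail G e \<in> D \<and> e \<in> tight l}. x e)"
        by (rule sum.mono_neutral_right) (use x_0 in auto)
      with tail_D show ?thesis by simp
    qed
    also have "\<dots> \<le> (\<Sum>e | e \<in> arcs G \<and> head G e \<in> D. x e)"
    proof (rule sum_mono2)
      show "insert e {e \<in> arcs G. tail G e \<in> D \<and> e \<in> tight l} \<subseteq> {e. e \<in> arcs G \<and> head G e \<in> D}"
      proof
        fix f assume "f \<in> insert e {e \<in> arcs G. tail G e \<in> D \<and> e \<in> tight l}"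
        then consider "f = e" | "f \<in> arcs G" "tail G f \<in> D" "f \<in> tight l" by blast
        then show "f \<in> {e. e \<in> arcs G \<and> head G e \<in> D}"
        proof cases
          case 1
          then show ?thesis using tight_arcs[OF e] by (auto simp: D_def)
        next
          case 2
          then have "(head G e, head G f) \<in> (tight_rel l)\<^sup>*"
            using tight_relI[of f l] by (auto simp: D_def intro: rtrancl_into_rtrancl)
          with 2 show ?thesis by (auto simp: D_def)
        qed
      qed
    qed (use x_nn in auto)
    finally have "x e \<le> (\<Sum>v\<in>D. netin z v)"
      by (simp add: netin sum_subtractf sum_arcs_by_vertex[OF \<open>D \<subseteq> verts G\<close>])
    also have "\<dots> \<le> (\<Sum>v\<in>D. b v)"
      by (rule sum_mono, rule netin_le) (use s_D in \<open>auto simp: D_def V_def\<close>)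
    also have "\<dots> \<le> u0" using u0 finite_subset[OF \<open>D \<subseteq> verts G\<close>] by (simp add: b_def)
    finally show ?thesis .
  qed (use x_0 u0 in simp)
  \<comment> \<open>Induction from \<open>s\<close> along tight arcs, now with
    \<open>x e \<le> u0\<close> available.\<close>
  have lam_less: "lam z w < Lb" if "w \<in> verts G" for w
    using that
  proof (induction w rule: wf_induct_rule[OF wf_tight_rel[of l]])
    case (1 w)
    show ?case
    proof (cases "w = s")
      case True
      then show ?thesis using Lb by (simp add: lam_def)
    next
      case False
      then obtain e where e: "e \<in> tight l" "head G e = w" using span 1(2) by (auto simp: tight_spanning_def)
      then have "lam z (tail G e) < Lb" using 1(1)[of "tail G e"] tight_relI[of e l] tight_arcs[of e l] by auto
      moreover have "x e / \<nu> e < Lb"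
      proof -
        have "x e / \<nu> e \<le> u0 / \<nu> e" using x_le[of e] \<nu>[OF e(1)] by (simp add: divide_right_mono)
        then show ?thesis using ratio[OF tight_arcs[OF e(1)]] by (simp add: Lb_def)
      qed
      ultimately have "slope_bound l e (lam z (tail G e)) (x e) < Lb" by (simp add: slope_bound_def)
      with arc(1)[OF e(1)] e(2) show ?thesis by simp
    qed
  qed
  have netin_eq: "netin z w = b w" if w: "w \<in> V" for w
  proof -
    have "z (Inl w) < Lb" using lam_less[of w] w by (auto simp: lam_def V_def)
    then have "b w \<le> netin z w" using zF(1)[of "Inl w"] w by (simp add: I_def m_def F_def)
    with netin_le[OF w] show ?thesis by simp
  qed
  have netin_s: "netin z s = - u0"
  proof -
    have "(\<Sum>v\<in>verts G. netin z v) = 0"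
    proof -
      have "{e \<in> arcs G. head G e \<in> verts G} = {e \<in> arcs G. tail G e \<in> verts G}" by auto
      then show ?thesis by (simp add: netin sum_subtractf sum_arcs_by_vertex)
    qed
    moreover have "(\<Sum>v\<in>verts G. netin z v) = netin z s + (\<Sum>v\<in>V. netin z v)"
      unfolding V_def by (rule sum.remove) (simp_all add: source_in_verts)
    moreover have "(\<Sum>v\<in>V. netin z v) = (\<Sum>v\<in>V. b v)" by (rule sum.cong) (simp_all add: netin_eq)
    moreover have "(\<Sum>v\<in>V. b v) = u0" using sink_in_verts sink_neq_source by (simp add: b_def V_def)
    ultimately show ?thesis by simp
  qed
  \<comment> \<open>Tracing flow back to where it comes from is what transports the equality of
    \<open>d\<close> and \<open>lam\<close> along arcs carrying flow.\<close>
  have fed: "tail G f = s \<or> (\<exists>e\<in>in_arcs G (tail G f). 0 < x e)" if f: "f \<in> tight l" "0 < x f" for f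
  proof (rule ccontr)
    define v where "v = tail G f"
    assume "\<not> (tail G f = s \<or> (\<exists>e\<in>in_arcs G (tail G f). 0 < x e))"
    then have *: "v \<noteq> s" "\<forall>e\<in>in_arcs G v. x e = 0" using x_nn by (auto simp: v_def less_le)
    have v: "v \<in> verts G" using tight_arcs[OF f(1)] by (simp add: v_def)
    have "netin z v = - (\<Sum>e\<in>out_arcs G v. x e)" using *(2) by (simp add: netin)
    moreover have "x f \<le> (\<Sum>e\<in>out_arcs G v. x e)"
      using tight_arcs[OF f(1)] x_nn by (intro member_le_sum) (auto simp: v_def)
    moreover have "0 \<le> netin z v" using netin_eq[of v] *(1) v u0 by (auto simp: V_def b_def)
    ultimately show False using f(2) by simp
  qed
  \<comment> \<open>The labels of vertices without inflow may be too small to be attained on an arc. Raising them to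
    the minimum of the slope bounds does not change the labels of vertices that carry flow.\<close>
  define H where "H = (\<lambda>d w. if w \<notin> verts G then 0 else if w = s then 1
     else Min ((\<lambda>e. slope_bound l e (d (tail G e)) (x e)) ` {e \<in> tight l. head G e = w}))"
  define d where "d = wfrec (tight_rel l) H"
  have d_rec: "d w = H d w" for w
  proof -
    have "d w = H (cut d (tight_rel l) w) w" unfolding d_def by (rule wfrec[OF wf_tight_rel])
    also have "\<dots> = H d w"
    proof -
      have "(\<lambda>e. slope_bound l e (cut d (tight_rel l) w (tail G e)) (x e)) ` {e \<in> tight l. head G e = w}
        = (\<lambda>e. slope_bound l e (d (tail G e)) (x e)) ` {e \<in> tight l. head G e = w}"
        by (rule image_cong) (use tight_relI in \<open>auto simp: cut_apply\<close>)
      then show ?thesis by (simp add: H_def)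
    qed
    finally show ?thesis .
  qed
  have d_s: "d s = 1" using d_rec[of s] source_in_verts by (simp add: H_def)
  have d_out: "d v = 0" if "v \<notin> verts G" for v using d_rec[of v] that by (simp add: H_def)
  have d_le: "d (head G e) \<le> slope_bound l e (d (tail G e)) (x e)" if e: "e \<in> tight l" for e
  proof -
    have "head G e \<in> verts G" "head G e \<noteq> s" using tight_arcs[OF e] head_tight_neq_source[OF span e] by auto
    then show ?thesis using d_rec[of "head G e"] e finite_tight[of l]
      by (auto simp: H_def intro!: Min_le)
  qed
  have d_ex: "\<exists>e\<in>tight l. head G e = w \<and> d w = slope_bound l e (d (tail G e)) (x e)" if w: "w \<in> V" for w
  proof -
    have "{e \<in> tight l. head G e = w} \<noteq> {}" using span w by (auto simp: tight_spanning_def V_def)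
    then have "Min ((\<lambda>e. slope_bound l e (d (tail G e)) (x e)) ` {e \<in> tight l. head G e = w})
      \<in> (\<lambda>e. slope_bound l e (d (tail G e)) (x e)) ` {e \<in> tight l. head G e = w}"
      using finite_tight[of l] by (intro Min_in) auto
    with d_rec[of w] w show ?thesis by (auto simp: H_def V_def)
  qed
  \<comment> \<open>Labels only rise, as slope bounds are monotone in the speed of the tail. Where
    flow arrives on \<open>f\<close>, the tail of \<open>f\<close> has kept its label, and the bound
    on \<open>f\<close> stops \<open>d w\<close> from rising.\<close>
  have d_lam: "lam z w \<le> d w \<and> (w = s \<or> (\<exists>e\<in>in_arcs G w. 0 < x e) \<longrightarrow> d w = lam z w)"
    if "w \<in> verts G" for w
    using that
  proof (induction w rule: wf_induct_rule[OF wf_tight_rel[of l]])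
    case (1 w)
    show ?case
    proof (cases "w = s")
      case True
      then show ?thesis by (simp add: lam_def d_s)
    next
      case False
      with 1(2) have w: "w \<in> V" by (simp add: V_def)
      obtain e where e: "e \<in> tight l" "head G e = w" "d w = slope_bound l e (d (tail G e)) (x e)"
        using d_ex[OF w] by blast
      have "lam z (tail G e) \<le> d (tail G e)"
        using 1(1)[of "tail G e"] tight_relI[OF e(1)] e tight_arcs[OF e(1)] by auto
      then have le: "lam z w \<le> d w" using arc(1)[OF e(1)] slope_bound_mono[of "lam z (tail G e)" "d (tail G e)" l e "x e"] e
        by auto
      moreover have "d w \<le> lam z w" if f: "f \<in> in_arcs G w" "0 < x f" for f
      proof -
        have ft: "f \<in> tight l" using x_0[of f] f by force
        define v where "v = tail G f"
        have v: "v \<in> verts G" "(v, w) \<in> tight_rel l" using tight_arcs[OF ft] tight_relI[OF ft] f by (auto simp: v_def)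
        have "v = s \<or> (\<exists>e\<in>in_arcs G v. 0 < x e)" using fed[OF ft f(2)] by (simp add: v_def)
        then have "d v = lam z v" using 1(1)[OF v(2,1)] by blast
        then show ?thesis using d_le[OF ft] arc(2)[OF ft f(2)] f(1) by (simp add: v_def)
      qed
      ultimately show ?thesis using False by force
    qed
  qed
  have "thin_flow l u0 d x" unfolding thin_flow_def
  proof (intro conjI allI ballI impI)
    show "0 \<le> d v" for v using d_lam[of v] lam_nn[of v] d_out[of v] by fastforce
    show "d v \<le> speed_bound u0" for v
    proof (cases "v \<in> verts G")
      case True
      then show ?thesis
      proof (induction v rule: wf_induct_rule[OF wf_tight_rel[of l]])
        case (1 w)
        show ?case
        proof (cases "w = s")
          case True
          then show ?thesis using d_s sb1 by simp
        next
          case False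
          then obtain e where e: "e \<in> tight l" "head G e = w" "d w = slope_bound l e (d (tail G e)) (x e)"
            using d_ex[of w] 1(2) by (auto simp: V_def)
          have "d (tail G e) \<le> speed_bound u0"
            using 1(1)[of "tail G e"] tight_relI[OF e(1)] e tight_arcs[OF e(1)] by auto
          moreover have "x e / \<nu> e \<le> u0 / \<nu> e" using x_le[of e] \<nu>[OF e(1)] by (simp add: divide_right_mono)
          ultimately show ?thesis using ratio[OF tight_arcs[OF e(1)]] e(3) by (auto simp: slope_bound_def)
        qed
      qed
    next
      case False
      then show ?thesis using d_out sb1 by simp
    qed
    show "d (head G e) = slope_bound l e (d (tail G e)) (x e)" if e: "e \<in> tight l" "0 < x e" for e
    proof (rule antisym[OF d_le[OF e(1)]])
      have h: "head G e \<in> verts G" "e \<in> in_arcs G (head G e)" using tight_arcs[OF e(1)] by auto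
      have "d (head G e) = lam z (head G e)" using d_lam[OF h(1)] h(2) e(2) by blast
      moreover have "d (tail G e) = lam z (tail G e)"
      proof -
        define v where "v = tail G e"
        have v: "v \<in> verts G" using tight_arcs[OF e(1)] by (auto simp: v_def)
        have "v = s \<or> (\<exists>e\<in>in_arcs G v. 0 < x e)" using fed[OF e] by (simp add: v_def)
        with d_lam[OF v] show ?thesis unfolding v_def by blast
      qed
      ultimately show "slope_bound l e (d (tail G e)) (x e) \<le> d (head G e)" using arc(2)[OF e] by simp
    qed
    show "(\<Sum>e\<in>out_arcs G v. x e) - (\<Sum>e\<in>in_arcs G v. x e) = (if v = s then u0 else if v = t then - u0 else 0)"
      if v: "v \<in> verts G" for v
      using netin_eq[of v] netin_s v netin[of v] by (auto simp: V_def b_def)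
    show "\<exists>e\<in>tight l. head G e = w \<and> d w = slope_bound l e (d (tail G e)) (x e)" if "w \<in> verts G - {s}" for w
      using d_ex[of w] that by (simp add: V_def)
  qed (use d_s d_out x_nn x_le x_0 d_le in auto)
  with that show thesis .
qed

lemma thin_flow_spanning: "thin_flow l u0 d x \<Longrightarrow> tight_spanning l"
  unfolding thin_flow_def tight_spanning_def by meson

text \<open>A short step keeps the sign of every nonzero gap. A zero gap becomes \<open>h\<close>
  times the speed of the head minus that of the tail. If this is negative, the arc ceases to be
  tight, and it carries no flow, since flow requires a head at least as fast as the tail. If it is
  positive, a queue starts; a head faster than the tail compares with the old bound, a maximum, as
  with \<open>x e / \<nu> e\<close>, the new bound.\<close>

lemma thin_flow_persists:
  assumes thin: "thin_flow l u0 d x"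
  shows "\<forall>\<^sub>F h in at_right 0. thin_flow (\<lambda>v. l v + h * d v) u0 d x"
proof -
  define gap where "gap e h = (l (head G e) + h * d (head G e)) - (l (tail G e) + h * d (tail G e)) - \<tau> e" for e h
  have lim: "(gap e \<longlongrightarrow> gap e 0) (at_right 0)" for e
    unfolding gap_def by (intro tendsto_intros)
  have "\<forall>\<^sub>F h in at_right 0. \<forall>e\<in>arcs G. (0 < gap e 0 \<longrightarrow> 0 < gap e h) \<and> (gap e 0 < 0 \<longrightarrow> gap e h < 0)"
  proof (intro eventually_ball_finite ballI finite_arcs eventually_conj)
    fix e
    show "\<forall>\<^sub>F h in at_right 0. 0 < gap e 0 \<longrightarrow> 0 < gap e h"
      using order_tendstoD(1)[OF lim, of 0 e] by (cases "0 < gap e 0") auto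
    show "\<forall>\<^sub>F h in at_right 0. gap e 0 < 0 \<longrightarrow> gap e h < 0"
      using order_tendstoD(2)[OF lim, of e 0] by (cases "gap e 0 < 0") auto
  qed
  moreover have "\<forall>\<^sub>F h in at_right (0::real). 0 < h" by (simp add: eventually_at_right_less)
  ultimately show ?thesis
  proof eventually_elim
    case (elim h)
    define l' where "l' = (\<lambda>v. l v + h * d v)"
    have tight: "e \<in> tight l \<longleftrightarrow> e \<in> arcs G \<and> 0 \<le> gap e 0" for e by (auto simp: tight_def gap_def)
    have tight': "e \<in> tight l' \<longleftrightarrow> e \<in> arcs G \<and> 0 \<le> gap e h" for e by (auto simp: tight_def gap_def l'_def)
    have sb: "slope_bound l e a y = (if 0 < gap e 0 then y / \<nu> e else max a (y / \<nu> e))"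
      "slope_bound l' e a y = (if 0 < gap e h then y / \<nu> e else max a (y / \<nu> e))" for e a y
      by (auto simp: slope_bound_def gap_def l'_def)
    have gap_h: "gap e h = h * (d (head G e) - d (tail G e))" if "gap e 0 = 0" for e
      using that by (simp add: gap_def algebra_simps)
    have sub: "e \<in> tight l" if "e \<in> tight l'" for e
      using that elim(1) tight tight' by (meson not_le)
    have keep: "e \<in> tight l'" "d (head G e) = slope_bound l' e (d (tail G e)) (x e)"
      if e: "e \<in> tight l" "d (head G e) = slope_bound l e (d (tail G e)) (x e)" for e
    proof -
      have arc: "e \<in> arcs G" using tight_arcs[OF e(1)] .
      have "e \<in> tight l' \<and> d (head G e) = slope_bound l' e (d (tail G e)) (x e)"
      proof (cases "0 < gap e 0")
        case True
        then have "0 < gap e h" using elim(1) arc by blast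
        with True show ?thesis using e(2) arc by (simp add: tight' sb)
      next
        case False
        then have "gap e 0 = 0" using e(1) by (simp add: tight)
        then have *: "gap e h = h * (d (head G e) - d (tail G e))" "d (head G e) = max (d (tail G e)) (x e / \<nu> e)"
          using gap_h e(2) by (simp_all add: sb)
        then have "0 \<le> gap e h" using elim(2) by simp
        moreover have "0 < gap e h \<longleftrightarrow> d (tail G e) < d (head G e)"
          unfolding *(1) using elim(2) by (simp add: zero_less_mult_iff)
        ultimately show ?thesis using *(2) arc by (auto simp: tight' sb)
      qed
      then show "e \<in> tight l'" "d (head G e) = slope_bound l' e (d (tail G e)) (x e)" by blast+
    qed
    have le: "d (head G e) \<le> slope_bound l' e (d (tail G e)) (x e)"
      if e: "e \<in> tight l'" "d (head G e) \<le> slope_bound l e (d (tail G e)) (x e)" for e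
    proof (cases "0 < gap e 0")
      case True
      moreover from this have "0 < gap e h" using elim(1) tight_arcs[OF e(1)] by blast
      ultimately show ?thesis using e(2) by (simp add: sb)
    next
      case False
      then have "gap e 0 = 0" using sub[OF e(1)] by (simp add: tight)
      then have "0 < gap e h \<longleftrightarrow> d (tail G e) < d (head G e)"
        using gap_h[of e] elim(2) by (simp add: zero_less_mult_iff)
      with False e(2) show ?thesis by (auto simp: sb)
    qed
    have "x e = 0" if "e \<notin> tight l'" for e
    proof (rule ccontr)
      assume "x e \<noteq> 0"
      then have "0 < x e" "e \<in> tight l" using thin unfolding thin_flow_def by (auto simp: less_le)
      with keep(1)[of e] thin that show False unfolding thin_flow_def by blast
    qed
    moreover have "\<exists>e\<in>tight l'. head G e = w \<and> d w = slope_bound l' e (d (tail G e)) (x e)"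
      if w: "w \<in> verts G - {s}" for w
    proof -
      obtain e where e: "e \<in> tight l" "head G e = w" "d w = slope_bound l e (d (tail G e)) (x e)"
        using thin w unfolding thin_flow_def by blast
      with keep[of e] show ?thesis by auto
    qed
    ultimately have "thin_flow l' u0 d x"
      using thin sub keep(2) le unfolding thin_flow_def by auto
    then show ?case by (simp add: l'_def)
  qed
qed

section \<open>The trajectory of earliest times\<close>

text \<open>Shortest-path distances, the earliest times in the empty network, serve as labels at
  time 0. The extended real \<open>\<mu>\<close> is finite because it is the cost of a path.\<close>

lemma static_distances:
  obtains D where "D s = 0" "\<And>v. v \<notin> verts G \<Longrightarrow> D v = (0::real)"
    "\<And>e. e \<in> arcs G \<Longrightarrow> D (head G e) \<le> D (tail G e) + \<tau> e"
    "\<And>w. w \<in> verts G - {s} \<Longrightarrow> \<exists>e\<in>arcs G. head G e = w \<and> D w = D (tail G e) + \<tau> e"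
proof -
  have nn: "0 \<le> \<tau> e" if "e \<in> arcs G" for e using that by (rule travel_time_nonneg)
  have mc: "\<exists>p. apath s p v \<and> \<mu> \<tau> s v = awalk_cost \<tau> p" if "v \<in> verts G" for v
    by (rule min_cost_awalk[OF reachable_from_source[OF that]]) (rule nn)
  have fin: "\<mu> \<tau> s v = ereal (real_of_ereal (\<mu> \<tau> s v))" if "v \<in> verts G" for v
    using mc[OF that] by auto
  define D where "D v = (if v \<in> verts G then real_of_ereal (\<mu> \<tau> s v) else 0)" for v
  have D: "ereal (D v) = \<mu> \<tau> s v" if "v \<in> verts G" for v using fin[OF that] that by (simp add: D_def)
  show thesis
  proof (rule that[of D])
    have "\<mu> \<tau> s s \<le> awalk_cost \<tau> []"
      by (rule min_cost_le_walk_cost) (simp add: awalk_Nil_iff source_in_verts)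
    moreover obtain p where "apath s p s" "\<mu> \<tau> s s = awalk_cost \<tau> p"
      using mc[OF source_in_verts] by blast
    moreover from this have "0 \<le> awalk_cost \<tau> p"
      using nn by (intro pos_cost_pos_awalk_cost) (auto simp: apath_def)
    ultimately have "\<mu> \<tau> s s = 0" by (metis antisym awalk_cost_Nil ereal_less_eq(5) zero_ereal_def)
    then show "D s = 0" using D[OF source_in_verts] by simp
    show "D v = 0" if "v \<notin> verts G" for v using that by (simp add: D_def)
    show "D (head G e) \<le> D (tail G e) + \<tau> e" if e: "e \<in> arcs G" for e
    proof -
      have "\<mu> \<tau> s (head G e) \<le> \<mu> \<tau> s (tail G e) + \<tau> e"
        by (rule pos_cost_mu_triangle[OF nn]) (use e in \<open>auto simp: arc_to_ends_def\<close>)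
      then have "ereal (D (head G e)) \<le> ereal (D (tail G e)) + ereal (\<tau> e)" using e by (simp add: D)
      then show ?thesis by simp
    qed
    show "\<exists>e\<in>arcs G. head G e = w \<and> D w = D (tail G e) + \<tau> e" if w: "w \<in> verts G - {s}" for w
    proof -
      obtain v e where e: "\<mu> \<tau> s w = \<mu> \<tau> s v + \<tau> e" "arc e (v, w)"
        using mu_exact_triangle_Ex[of w s \<tau>] w reachable_from_source nn by auto
      then have a: "e \<in> arcs G" "tail G e = v" "head G e = w" by (auto simp: arc_def)
      then have v: "v \<in> verts G" by auto
      have "ereal (D w) = ereal (D v) + ereal (\<tau> e)" using e(1) w D[OF v] D[of w] by (metis DiffD1)
      with a show ?thesis by auto
    qed
  qed
qed

text \<open>If all of the finitely many arcs into \<open>w\<close> are slack in the limit, they are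
  slack already for some \<open>Y n\<close>.\<close>

lemma tight_spanning_closed:
  assumes Y: "\<And>n. tight_spanning (Y n)" and lim: "\<And>v. (\<lambda>n. Y n v) \<longlonglongrightarrow> y v"
  shows "tight_spanning y"
  unfolding tight_spanning_def
proof (rule ballI, rule ccontr)
  fix w assume w: "w \<in> verts G - {s}" and "\<not> (\<exists>e\<in>tight y. head G e = w)"
  have slack: "0 < y (tail G e) + \<tau> e - y (head G e)" if "e \<in> in_arcs G w" for e
  proof (rule ccontr)
    assume "\<not> ?thesis"
    with that have "e \<in> tight y" "head G e = w" by (auto simp: tight_def)
    with \<open>\<not> (\<exists>e\<in>tight y. head G e = w)\<close> show False by blast
  qed
  have "\<forall>\<^sub>F n in sequentially. \<forall>e\<in>in_arcs G w. 0 < Y n (tail G e) + \<tau> e - Y n (head G e)"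
  proof (intro eventually_ball_finite ballI finite_in_arcs)
    fix e assume e: "e \<in> in_arcs G w"
    have "(\<lambda>n. Y n (tail G e) + \<tau> e - Y n (head G e)) \<longlonglongrightarrow> y (tail G e) + \<tau> e - y (head G e)"
      by (intro tendsto_intros lim)
    from order_tendstoD(1)[OF this slack[OF e]]
    show "\<forall>\<^sub>F n in sequentially. 0 < Y n (tail G e) + \<tau> e - Y n (head G e)" .
  qed
  then obtain n where "\<forall>e\<in>in_arcs G w. 0 < Y n (tail G e) + \<tau> e - Y n (head G e)"
    by (auto simp: eventually_sequentially)
  moreover obtain e where "e \<in> tight (Y n)" "head G e = w" using Y[of n] w by (auto simp: tight_spanning_def)
  moreover from this have "e \<in> in_arcs G w" by (auto dest: tight_arcs)
  ultimately have "0 < Y n (tail G e) + \<tau> e - Y n (head G e)" "e \<in> tight (Y n)" by blast+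
  then show False by (simp add: tight_def)
qed

lemma thin_flow_trajectory_exists:
  assumes u: "\<And>\<theta>. \<forall>\<^sub>F h in at_right 0. u (\<theta> + h) = u \<theta>" "\<And>\<theta>. bdd_above (u ` {0..\<theta>})"
    "\<And>\<theta>. 0 \<le> u \<theta>" "\<And>\<theta>. \<theta> < 0 \<Longrightarrow> u \<theta> = 0"
  obtains l d :: "'a \<Rightarrow> real \<Rightarrow> real" and X x :: "'b \<Rightarrow> real \<Rightarrow> real"
  where "\<And>v. slopes (l v) (d v)" "\<And>e. slopes (X e) (x e)" "\<And>\<theta>. l s \<theta> = \<theta>"
    "\<And>\<theta>. thin_flow (\<lambda>v. l v \<theta>) (u \<theta>) (\<lambda>v. d v \<theta>) (\<lambda>e. x e \<theta>)"
    "\<And>v \<theta>. v \<in> verts G \<Longrightarrow> \<theta> \<le> 0 \<Longrightarrow> l v \<theta> = l v 0 + \<theta>"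
    "\<And>e \<theta>. \<theta> \<le> 0 \<Longrightarrow> X e \<theta> = 0"
proof -
  obtain D0 where D0: "D0 s = 0" "\<And>v. v \<notin> verts G \<Longrightarrow> D0 v = (0::real)"
    "\<And>e. e \<in> arcs G \<Longrightarrow> D0 (head G e) \<le> D0 (tail G e) + \<tau> e"
    "\<And>w. w \<in> verts G - {s} \<Longrightarrow> \<exists>e\<in>arcs G. head G e = w \<and> D0 w = D0 (tail G e) + \<tau> e"
    using static_distances by blast
  define y0 where "y0 = case_sum D0 (\<lambda>_::'b. 0::real)"
  \<comment> \<open>The invariant concerns the state only: at a limit of phases the labels converge,
    whereas the speeds may jump.\<close>
  define J where "J \<theta> y \<longleftrightarrow> y (Inl s) = \<theta> \<and> tight_spanning (\<lambda>v. y (Inl v))" for \<theta> and y :: "'a + 'b \<Rightarrow> real"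
  define P where "P \<theta> y d \<longleftrightarrow> thin_flow (\<lambda>v. y (Inl v)) (u \<theta>) (\<lambda>v. d (Inl v)) (\<lambda>e. d (Inr e))"
    for \<theta> and y d :: "'a + 'b \<Rightarrow> real"
  \<comment> \<open>The running supremum makes the Lipschitz bound \<open>L\<close>
    monotone.\<close>
  define U where "U \<theta> = Sup (u ` {0..\<theta>})" for \<theta>
  define L where "L \<theta> = speed_bound (U \<theta>) + U \<theta>" for \<theta>
  have uU: "u \<theta> \<le> U \<theta>" if "0 \<le> \<theta>" for \<theta>
    unfolding U_def by (rule cSup_upper[OF _ u(2)]) (use that in auto)
  have U_mono: "U a \<le> U b" if "0 \<le> a" "a \<le> b" for a b
    unfolding U_def by (rule cSup_subset_mono[OF _ u(2)]) (use that in auto)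
  have \<nu>sum: "0 \<le> (\<Sum>e\<in>arcs G. 1 / \<nu> e)"
    using service_rate_pos by (auto intro!: sum_nonneg simp: less_imp_le)
  have speed_mono: "speed_bound a \<le> speed_bound b" if "a \<le> b" for a b
    unfolding speed_bound_def using mult_right_mono[OF that \<nu>sum] by simp
  have L_mono: "L a \<le> L b" if "0 \<le> a" "a \<le> b" for a b
    using U_mono[OF that] speed_mono[of "U a" "U b"] by (simp add: L_def)
  have J0: "J 0 y0" using D0(1,4) by (fastforce simp: J_def y0_def tight_spanning_def tight_def)
  have closed: "J \<theta> y" if "\<And>n. J (\<Theta> n) (Y n)" "\<Theta> \<longlonglongrightarrow> \<theta>" "\<And>i. (\<lambda>n. Y n i) \<longlonglongrightarrow> y i" for \<Theta> Y \<theta> y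
  proof -
    have "(\<lambda>n. Y n (Inl s)) = \<Theta>" using that(1) by (auto simp: J_def)
    then have "y (Inl s) = \<theta>" using that(2) that(3)[of "Inl s"] LIMSEQ_unique by metis
    moreover have "tight_spanning (\<lambda>v. y (Inl v))"
      by (rule tight_spanning_closed[of "\<lambda>n v. Y n (Inl v)"]) (use that in \<open>auto simp: J_def\<close>)
    ultimately show ?thesis by (simp add: J_def)
  qed
  have step: "\<exists>d. (\<forall>i. \<bar>d i\<bar> \<le> L \<theta>) \<and> P \<theta> y d \<and>
      (\<forall>\<^sub>F h in at_right 0. J (\<theta> + h) (\<lambda>i. y i + h * d i) \<and> P (\<theta> + h) (\<lambda>i. y i + h * d i) d)"
    if \<theta>: "0 \<le> \<theta>" and J: "J \<theta> y" for \<theta> y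
  proof -
    obtain d x where dx: "thin_flow (\<lambda>v. y (Inl v)) (u \<theta>) d x"
      using thin_flow_exists[of "\<lambda>v. y (Inl v)" "u \<theta>"] J u(3) by (auto simp: J_def)
    define c where "c = case_sum d x"
    have "\<bar>c i\<bar> \<le> L \<theta>" for i
    proof -
      have "0 \<le> U \<theta>" "0 \<le> u \<theta>" using uU[OF \<theta>] u(3)[of \<theta>] by linarith+
      moreover have "speed_bound (u \<theta>) \<le> speed_bound (U \<theta>)" by (rule speed_mono[OF uU[OF \<theta>]])
      moreover have "1 \<le> speed_bound (U \<theta>)" using \<open>0 \<le> U \<theta>\<close> \<nu>sum by (simp add: speed_bound_def)
      moreover have "0 \<le> d v \<and> d v \<le> speed_bound (u \<theta>)" "0 \<le> x e \<and> x e \<le> u \<theta>" for v e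
        using dx by (simp_all add: thin_flow_def)
      ultimately show ?thesis using uU[OF \<theta>] unfolding c_def L_def
        by (cases i) (smt (verit) sum.case)+
    qed
    moreover have "P \<theta> y c" using dx by (simp add: P_def c_def)
    moreover have "\<forall>\<^sub>F h in at_right 0. J (\<theta> + h) (\<lambda>i. y i + h * c i) \<and> P (\<theta> + h) (\<lambda>i. y i + h * c i) c"
      using thin_flow_persists[OF dx] u(1)[of \<theta>]
    proof eventually_elim
      case (elim h)
      have "d s = 1" using dx by (simp add: thin_flow_def)
      with elim J thin_flow_spanning[OF elim(1)] show ?case by (simp add: J_def P_def c_def)
    qed
    ultimately show ?thesis by blast
  qed
  obtain Y D where Y0: "Y 0 = y0" and YD: "\<And>\<theta>. 0 \<le> \<theta> \<Longrightarrow> J \<theta> (Y \<theta>) \<and> P \<theta> (Y \<theta>) (D \<theta>)"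
    and Ystep: "\<And>\<theta>. 0 \<le> \<theta> \<Longrightarrow> \<forall>\<^sub>F h in at_right 0. Y (\<theta> + h) = (\<lambda>i. Y \<theta> i + h * D \<theta> i) \<and> D (\<theta> + h) = D \<theta>"
    and YL: "\<And>\<theta> \<theta>' i. 0 \<le> \<theta> \<Longrightarrow> \<theta> \<le> \<theta>' \<Longrightarrow> \<bar>Y \<theta> i - Y \<theta>' i\<bar> \<le> L \<theta>' * (\<theta>' - \<theta>)"
  proof (rule right_linear_evolution[where J = J and L = L and P = P, OF J0])
    show "J \<theta> y" if "\<And>n. J (\<Theta> n) (Y n)" "\<Theta> \<longlonglongrightarrow> \<theta>" "\<And>i. (\<lambda>n. Y n i) \<longlonglongrightarrow> y i" for \<Theta> Y \<theta> y
      using that by (rule closed)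
    show "L a \<le> L b" if "0 \<le> a" "a \<le> b" for a b using that by (rule L_mono)
  qed (use step in blast, rule that)
  define c where "c = (case_sum (\<lambda>v. if v \<in> verts G then 1 else 0) (\<lambda>_. 0) :: 'a + 'b \<Rightarrow> real)"
  \<comment> \<open>Before time \<open>0\<close> all labels of vertices move with speed \<open>1\<close>.\<close>
  define Z where "Z \<theta> i = Y (max 0 \<theta>) i + min 0 \<theta> * c i" for \<theta> i
  define E where "E \<theta> = (if \<theta> < 0 then c else D \<theta>)" for \<theta>
  have Y_cont: "isCont (\<lambda>\<theta>. Y (max 0 \<theta>) i) \<theta>" for i \<theta>
  proof -
    have "\<forall>\<^sub>F a in at \<theta>. norm (Y (max 0 a) i - Y (max 0 \<theta>) i) \<le> \<bar>a - \<theta>\<bar> * L (max 0 \<theta> + 1)"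
      unfolding eventually_at
    proof (intro exI[of _ 1] conjI ballI impI)
      fix a assume a: "a \<noteq> \<theta> \<and> dist a \<theta> < 1"
      define p q where "p = min (max 0 a) (max 0 \<theta>)" and "q = max (max 0 a) (max 0 \<theta>)"
      have pq: "0 \<le> p" "p \<le> q" "q - p \<le> \<bar>a - \<theta>\<bar>" "q \<le> max 0 \<theta> + 1"
        using a by (auto simp: p_def q_def dist_real_def)
      have L: "L q \<le> L (max 0 \<theta> + 1)" "0 \<le> L (max 0 \<theta> + 1)"
      proof -
        show "L q \<le> L (max 0 \<theta> + 1)" using pq by (intro L_mono) auto
        have "0 \<le> L 0" using YL[of 0 1 i] step[OF order_refl J0] by (meson abs_ge_zero order_trans)
        then show "0 \<le> L (max 0 \<theta> + 1)" using L_mono[of 0 "max 0 \<theta> + 1"] by simp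
      qed
      have "norm (Y (max 0 a) i - Y (max 0 \<theta>) i) = \<bar>Y p i - Y q i\<bar>"
        by (auto simp: p_def q_def min_def max_def abs_minus_commute)
      also have "\<dots> \<le> L q * (q - p)" using YL pq by blast
      also have "\<dots> \<le> L (max 0 \<theta> + 1) * \<bar>a - \<theta>\<bar>" using L pq by (intro mult_mono) auto
      finally show "norm (Y (max 0 a) i - Y (max 0 \<theta>) i) \<le> \<bar>a - \<theta>\<bar> * L (max 0 \<theta> + 1)"
        by (simp add: mult.commute)
    qed simp
    moreover have "((\<lambda>a. \<bar>a - \<theta>\<bar> * L (max 0 \<theta> + 1)) \<longlongrightarrow> 0) (at \<theta>)"
    proof -
      have "((\<lambda>a. \<bar>a - \<theta>\<bar> * L (max 0 \<theta> + 1)) \<longlongrightarrow> \<bar>\<theta> - \<theta>\<bar> * L (max 0 \<theta> + 1)) (at \<theta>)"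
        by (intro tendsto_intros)
      then show ?thesis by simp
    qed
    ultimately have "((\<lambda>a. Y (max 0 a) i - Y (max 0 \<theta>) i) \<longlongrightarrow> 0) (at \<theta>)"
      by (rule Lim_null_comparison)
    then show ?thesis by (simp add: isCont_def LIM_zero_iff)
  qed
  have Z_slopes: "slopes (\<lambda>\<theta>. Z \<theta> i) (\<lambda>\<theta>. E \<theta> i)" for i
    unfolding slopes_def
  proof (intro allI conjI)
    fix \<theta>
    show "isCont (\<lambda>\<theta>. Z \<theta> i) \<theta>" unfolding Z_def by (intro continuous_intros Y_cont)
    show "\<forall>\<^sub>F h in at_right 0. Z (\<theta> + h) i = Z \<theta> i + h * E \<theta> i \<and> E (\<theta> + h) i = E \<theta> i"
    proof (cases "\<theta> < 0")
      case True
      then show ?thesis unfolding eventually_at_right_field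
        by (intro exI[of _ "- \<theta>"]) (auto simp: Z_def E_def algebra_simps)
    next
      case False
      then have "0 \<le> \<theta>" by simp
      have "\<forall>\<^sub>F h in at_right (0::real). 0 < h" by (simp add: eventually_at_right_less)
      with Ystep[OF \<open>0 \<le> \<theta>\<close>] show ?thesis
        by eventually_elim (use \<open>0 \<le> \<theta>\<close> in \<open>auto simp: Z_def E_def\<close>)
    qed
  qed
  have Z_nonpos: "Z \<theta> i = y0 i + \<theta> * c i" if "\<theta> \<le> 0" for \<theta> i using that by (simp add: Z_def Y0)
  show thesis
  proof (rule that[of "\<lambda>v \<theta>. Z \<theta> (Inl v)" "\<lambda>v \<theta>. E \<theta> (Inl v)" "\<lambda>e \<theta>. Z \<theta> (Inr e)" "\<lambda>e \<theta>. E \<theta> (Inr e)"])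
    show "Z \<theta> (Inl s) = \<theta>" for \<theta>
      using YD[of "max 0 \<theta>"] source_in_verts by (auto simp: Z_def J_def c_def)
    show "Z \<theta> (Inl v) = Z 0 (Inl v) + \<theta>" if "v \<in> verts G" "\<theta> \<le> 0" for v \<theta>
      using that by (simp add: Z_nonpos c_def)
    show "Z \<theta> (Inr e) = 0" if "\<theta> \<le> 0" for e \<theta> using that by (simp add: Z_nonpos c_def y0_def)
    show "thin_flow (\<lambda>v. Z \<theta> (Inl v)) (u \<theta>) (\<lambda>v. E \<theta> (Inl v)) (\<lambda>e. E \<theta> (Inr e))" for \<theta>
    proof (cases "\<theta> < 0")
      case False
      then show ?thesis using YD[of \<theta>] by (simp add: Z_def E_def P_def)
    next
      case True
      \<comment> \<open>A common shift of all labels preserves the gaps, so no tight arc has a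
        queue, and unit speeds with zero flow form a thin flow.\<close>
      define l where "l = (\<lambda>v. Z \<theta> (Inl v))"
      have l: "l v = D0 v + \<theta>" if "v \<in> verts G" for v
        using True that by (simp add: l_def Z_nonpos y0_def c_def)
      have tight: "e \<in> tight l \<longleftrightarrow> e \<in> arcs G \<and> D0 (head G e) = D0 (tail G e) + \<tau> e" for e
        using D0(3)[of e] by (auto simp: tight_def l)
      have sb: "slope_bound l e a y = max a (y / \<nu> e)" if "e \<in> tight l" for e a y
        using that tight by (auto simp: slope_bound_def l)
      have "\<exists>e\<in>tight l. head G e = w" if "w \<in> verts G - {s}" for w
        using D0(4)[OF that] tight by blast
      then have "\<exists>e\<in>tight l. head G e = w \<and> 1 = slope_bound l e 1 0" if "w \<in> verts G - {s}" for w
        using that sb by (metis div_0 max.absorb1 zero_le_one)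
      then have "thin_flow l 0 (\<lambda>v. if v \<in> verts G then 1 else 0) (\<lambda>_. 0)"
        unfolding thin_flow_def using source_in_verts by (auto simp: sb speed_bound_def tight)
      then show ?thesis using True u(4)[of \<theta>] by (simp add: l_def E_def c_def)
    qed
  qed (use Z_slopes in auto)
qed

end

section \<open>The flow induced by a trajectory\<close>

locale thin_flow_trajectory = network G \<nu> \<tau> s t
  for G :: "('a, 'b) pre_digraph" and \<nu> \<tau> s t +
  fixes u :: "real \<Rightarrow> real" and l d :: "'a \<Rightarrow> real \<Rightarrow> real" and X x :: "'b \<Rightarrow> real \<Rightarrow> real"
  assumes l_slopes: "slopes (l v) (d v)" and X_slopes: "slopes (X e) (x e)"
    and l_source: "l s \<theta> = \<theta>"
    and thin: "thin_flow (\<lambda>v. l v \<theta>) (u \<theta>) (\<lambda>v. d v \<theta>) (\<lambda>e. x e \<theta>)"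
    and l_nonpos: "v \<in> verts G \<Longrightarrow> \<theta> \<le> 0 \<Longrightarrow> l v \<theta> = l v 0 + \<theta>"
    and X_nonpos: "\<theta> \<le> 0 \<Longrightarrow> X e \<theta> = 0"
begin

abbreviation tight_at :: "real \<Rightarrow> 'b set" where "tight_at \<theta> \<equiv> tight (\<lambda>v. l v \<theta>)"

lemma thinD:
  "d s \<theta> = 1" "0 \<le> d v \<theta>" "0 \<le> x e \<theta>" "x e \<theta> \<le> u \<theta>" "e \<notin> tight_at \<theta> \<Longrightarrow> x e \<theta> = 0"
  "e \<in> tight_at \<theta> \<Longrightarrow> d (head G e) \<theta> \<le> slope_bound (\<lambda>v. l v \<theta>) e (d (tail G e) \<theta>) (x e \<theta>)"
  "0 < x e \<theta> \<Longrightarrow> d (head G e) \<theta> = slope_bound (\<lambda>v. l v \<theta>) e (d (tail G e) \<theta>) (x e \<theta>)"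
  "v \<in> verts G \<Longrightarrow> (\<Sum>e\<in>out_arcs G v. x e \<theta>) - (\<Sum>e\<in>in_arcs G v. x e \<theta>)
     = (if v = s then u \<theta> else if v = t then - u \<theta> else 0)"
proof -
  note * = thin[of \<theta>, unfolded thin_flow_def]
  show "d s \<theta> = 1" "0 \<le> d v \<theta>" "0 \<le> x e \<theta>" "x e \<theta> \<le> u \<theta>" using * by blast+
  show 0: "e \<notin> tight_at \<theta> \<Longrightarrow> x e \<theta> = 0" using * by blast
  show "e \<in> tight_at \<theta> \<Longrightarrow> d (head G e) \<theta> \<le> slope_bound (\<lambda>v. l v \<theta>) e (d (tail G e) \<theta>) (x e \<theta>)"
    using * by blast
  show "0 < x e \<theta> \<Longrightarrow> d (head G e) \<theta> = slope_bound (\<lambda>v. l v \<theta>) e (d (tail G e) \<theta>) (x e \<theta>)"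
    using * 0 by (metis less_irrefl)
  show "v \<in> verts G \<Longrightarrow> (\<Sum>e\<in>out_arcs G v. x e \<theta>) - (\<Sum>e\<in>in_arcs G v. x e \<theta>)
     = (if v = s then u \<theta> else if v = t then - u \<theta> else 0)" using * by blast
qed

section \<open>Inverse labels and cumulative flow in local time\<close>

lemma l_mono: "a \<le> b \<Longrightarrow> l v a \<le> l v b"
  using slopes_mono[OF l_slopes thinD(2)] by (simp add: mono_def)

lemma X_mono: "a \<le> b \<Longrightarrow> X e a \<le> X e b"
  using slopes_mono[OF X_slopes thinD(3)] by (simp add: mono_def)

lemma l_ge: "v \<in> verts G \<Longrightarrow> \<theta> \<le> l v \<theta>"
  using tight_spanning_ge_source[OF thin_flow_spanning[OF thin], of v \<theta>] by (simp add: l_source)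

text \<open>Unit speed at negative times makes \<open>l v\<close> unbounded below, and it dominates
  the identity. So any time can be written as a label of \<open>v\<close>.\<close>

lemma l_surj:
  assumes "v \<in> verts G" shows "\<exists>\<theta>. l v \<theta> = \<xi>"
proof -
  define a where "a = min 0 (\<xi> - l v 0)"
  have "l v a \<le> \<xi>" using l_nonpos[OF assms, of a] by (simp add: a_def)
  moreover have "\<xi> \<le> l v (max a \<xi>)" using l_ge[OF assms, of "max a \<xi>"] by simp
  moreover have "continuous_on {a..max a \<xi>} (l v)"
    using slopesD(1)[OF l_slopes] by (simp add: continuous_at_imp_continuous_on)
  ultimately show ?thesis using IVT'[of "l v" a \<xi> "max a \<xi>"] by auto
qed

text \<open>The latest departure from \<open>s\<close> that reaches \<open>v\<close> by
  \<open>\<xi>\<close>. On a plateau of \<open>l v\<close> the supremum picks the right end, where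
  \<open>l v\<close> starts to grow; hence \<open>d_pos_r\<close>, which makes divisions by
  \<open>d v (r v \<xi>)\<close> legitimate.\<close>

definition r :: "'a \<Rightarrow> real \<Rightarrow> real" where "r v \<xi> = Sup {\<theta>. l v \<theta> \<le> \<xi>}"

lemma l_closed: "closed {\<theta>. l v \<theta> \<le> \<xi>}" "closed {\<theta>. \<xi> \<le> l v \<theta>}"
proof -
  have "continuous_on UNIV (l v)" using slopesD(1)[OF l_slopes] by (simp add: continuous_at_imp_continuous_on)
  then show "closed {\<theta>. l v \<theta> \<le> \<xi>}" "closed {\<theta>. \<xi> \<le> l v \<theta>}"
    by (auto intro!: closed_Collect_le continuous_on_const)
qed

lemma
  assumes v: "v \<in> verts G"
  shows l_r: "l v (r v \<xi>) = \<xi>" and le_r_iff: "\<theta> \<le> r v \<xi> \<longleftrightarrow> l v \<theta> \<le> \<xi>"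
proof -
  obtain a where a: "l v a = \<xi>" using l_surj[OF v] by blast
  have bd: "bdd_above {\<theta>. l v \<theta> \<le> \<xi>}" by (rule bdd_aboveI[of _ \<xi>]) (use l_ge[OF v] in \<open>auto intro: order_trans\<close>)
  have ne: "{\<theta>. l v \<theta> \<le> \<xi>} \<noteq> {}" using a by auto
  have "l v (r v \<xi>) \<le> \<xi>" using closed_contains_Sup[OF ne bd l_closed(1)] by (simp add: r_def)
  moreover have up: "\<theta> \<le> r v \<xi>" if "l v \<theta> \<le> \<xi>" for \<theta>
    unfolding r_def by (rule cSup_upper[OF _ bd]) (use that in simp)
  ultimately show eq: "l v (r v \<xi>) = \<xi>" using l_mono[OF up[of a], of v] a by simp
  show "\<theta> \<le> r v \<xi> \<longleftrightarrow> l v \<theta> \<le> \<xi>" using up l_mono[of \<theta> "r v \<xi>" v] eq by auto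
qed

lemma r_le: "v \<in> verts G \<Longrightarrow> r v \<xi> \<le> \<xi>"
  using l_ge[of v "r v \<xi>"] l_r by simp

lemma r_mono: "v \<in> verts G \<Longrightarrow> a \<le> b \<Longrightarrow> r v a \<le> r v b"
  by (simp add: le_r_iff l_r)

lemma d_pos_r: assumes v: "v \<in> verts G" shows "0 < d v (r v \<xi>)"
proof -
  obtain e where e: "0 < e" "\<And>h. 0 < h \<Longrightarrow> h \<le> e \<Longrightarrow> l v (r v \<xi> + h) = l v (r v \<xi>) + h * d v (r v \<xi>) \<and> d v (r v \<xi> + h) = d v (r v \<xi>)"
    using slopes_linear_piece[OF l_slopes[of v], of "r v \<xi>"] by blast
  have "\<xi> < l v (r v \<xi> + e)" using le_r_iff[OF v, of "r v \<xi> + e" \<xi>] e(1) by linarith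
  then have "\<xi> < \<xi> + e * d v (r v \<xi>)" using e(2)[of e] e(1) l_r[OF v, of \<xi>] by simp
  with e(1) show ?thesis by (simp add: zero_less_mult_iff)
qed

lemma flat_imp_d_zero:
  assumes "a < b" "l v a = l v b" shows "d v a = 0"
proof -
  obtain e where e: "0 < e" "\<And>h. 0 < h \<Longrightarrow> h \<le> e \<Longrightarrow> l v (a + h) = l v a + h * d v a \<and> d v (a + h) = d v a"
    using slopes_linear_piece[OF l_slopes[of v], of a] by blast
  define h where "h = min e (b - a)"
  have h: "0 < h" "h \<le> e" "a + h \<le> b" using e(1) assms(1) by (auto simp: h_def)
  have "l v (a + h) = l v a" using l_mono[of a "a + h" v] l_mono[OF h(3), of v] assms(2) h(1) by simp
  with e(2)[OF h(1,2)] h(1) show ?thesis by simp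
qed

lemma x_zero_if_head_stalls:
  assumes "e \<in> arcs G" "d (head G e) \<theta> = 0" shows "x e \<theta> = 0"
proof (rule ccontr)
  assume "x e \<theta> \<noteq> 0"
  then have pos: "0 < x e \<theta>" using thinD(3)[of e \<theta>] by simp
  then have "0 < x e \<theta> / \<nu> e" using service_rate_pos[OF assms(1)] by simp
  also have "\<dots> \<le> d (head G e) \<theta>" using thinD(7)[OF pos] slope_bound_ge by simp
  finally show False using assms(2) by simp
qed

text \<open>A stalled vertex receives no flow, hence emits none. It cannot be \<open>s\<close>,
  which moves at speed 1, and at \<open>t\<close> the balance is \<open>- u \<theta>\<close>, which
  is not positive.\<close>

lemma x_zero_if_tail_stalls:
  assumes e: "e \<in> arcs G" "d (tail G e) \<theta> = 0" shows "x e \<theta> = 0"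
proof -
  define v where "v = tail G e"
  have v: "v \<in> verts G" "v \<noteq> s" using e thinD(1)[of \<theta>] by (auto simp: v_def)
  have "x f \<theta> = 0" if "f \<in> in_arcs G v" for f
    using that e(2) by (intro x_zero_if_head_stalls) (auto simp: v_def)
  then have "(\<Sum>e\<in>out_arcs G v. x e \<theta>) = (if v = t then - u \<theta> else 0)" using thinD(8)[OF v(1), of \<theta>] v(2) by simp
  moreover have "0 \<le> u \<theta>" using thinD(3,4)[of e \<theta>] by simp
  moreover have "x e \<theta> \<le> (\<Sum>e\<in>out_arcs G v. x e \<theta>)"
    using e(1) thinD(3) by (intro member_le_sum) (auto simp: v_def)
  ultimately show ?thesis using thinD(3)[of e \<theta>] by (simp split: if_splits)
qed

lemma x_zero_neg: assumes "\<theta> < 0" shows "x e \<theta> = 0"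
proof -
  obtain k where k: "0 < k" "\<And>h. 0 < h \<Longrightarrow> h \<le> k \<Longrightarrow> X e (\<theta> + h) = X e \<theta> + h * x e \<theta> \<and> x e (\<theta> + h) = x e \<theta>"
    using slopes_linear_piece[OF X_slopes[of e], of \<theta>] by blast
  define h where "h = min k (- \<theta>)"
  have "0 < h" "h \<le> k" "\<theta> + h \<le> 0" using k(1) assms by (auto simp: h_def)
  with k(2)[of h] X_nonpos[of "\<theta> + h" e] X_nonpos[of \<theta> e] assms show ?thesis by simp
qed

text \<open>Between \<open>\<theta>\<close> and the right end of its plateau \<open>d v\<close>
  vanishes, and with it \<open>x e\<close>. So \<open>X e\<close> depends only on the arrival time
  at \<open>v\<close>.\<close>

lemma X_r_l:
  assumes v: "v \<in> verts G" and stall: "\<And>\<theta>. d v \<theta> = 0 \<Longrightarrow> x e \<theta> = 0"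
  shows "X e (r v (l v \<theta>)) = X e \<theta>"
proof -
  have le: "\<theta> \<le> r v (l v \<theta>)" using le_r_iff[OF v] by simp
  have "X e (r v (l v \<theta>)) - X e \<theta> = 0 * (X e (r v (l v \<theta>)) - X e \<theta>)"
  proof (rule slopes_eq_diff[OF X_slopes X_slopes le])
    fix \<zeta> assume \<zeta>: "\<theta> \<le> \<zeta>" "\<zeta> < r v (l v \<theta>)"
    then have "l v \<zeta> = l v (r v (l v \<theta>))"
      using l_mono[OF \<zeta>(1), of v] l_mono[of \<zeta> "r v (l v \<theta>)" v] by (simp add: l_r[OF v])
    from stall[OF flat_imp_d_zero[OF \<zeta>(2) this]] show "x e \<zeta> = 0 * x e \<zeta>" by simp
  qed
  then show ?thesis by simp
qed

text \<open>The chain rule in the local time of \<open>v\<close>. Continuity survives the jumps of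
  \<open>r v\<close> because \<open>X e\<close> is constant on the plateaus of
  \<open>l v\<close>.\<close>

lemma X_r_slopes:
  assumes v: "v \<in> verts G" and stall: "\<And>\<theta>. d v \<theta> = 0 \<Longrightarrow> x e \<theta> = 0"
  shows "slopes (\<lambda>\<xi>. X e (r v \<xi>)) (\<lambda>\<xi>. x e (r v \<xi>) / d v (r v \<xi>))"
  unfolding slopes_def
proof (intro allI conjI)
  fix \<xi>
  define \<theta> where "\<theta> = r v \<xi>"
  have l\<theta>: "l v \<theta> = \<xi>" by (simp add: \<theta>_def l_r[OF v])
  have \<delta>: "0 < d v \<theta>" using d_pos_r[OF v] by (simp add: \<theta>_def)
  show "isCont (\<lambda>\<xi>. X e (r v \<xi>)) \<xi>"
    unfolding continuous_at_eps_delta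
  proof (intro allI impI)
    fix \<epsilon> :: real assume \<epsilon>: "0 < \<epsilon>"
    have X_near: "\<exists>\<delta>>0. \<forall>a. \<bar>a - b\<bar> < \<delta> \<longrightarrow> \<bar>X e a - X e b\<bar> < \<epsilon>" for b
      using slopesD(1)[OF X_slopes, of b e] \<epsilon> unfolding continuous_at_eps_delta dist_real_def by blast
    \<comment> \<open>The left end of the plateau whose right end is \<open>\<theta>\<close>.
      Approaching \<open>\<xi>\<close> from below leads to \<open>\<theta>'\<close>, from above to
      \<open>\<theta>\<close>, and \<open>X e\<close> agrees at both.\<close>
    define \<theta>' where "\<theta>' = Inf {\<theta>. \<xi> \<le> l v \<theta>}"
    obtain b where b: "l v b = \<xi> - 1" using l_surj[OF v] by blast
    have bd: "bdd_below {\<theta>. \<xi> \<le> l v \<theta>}"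
    proof (rule bdd_belowI[of _ b])
      fix a assume "a \<in> {\<theta>. \<xi> \<le> l v \<theta>}"
      with b l_mono[of a b v] show "b \<le> a" by (cases "a \<le> b") auto
    qed
    have ne: "{\<theta>. \<xi> \<le> l v \<theta>} \<noteq> {}" using l\<theta> by auto
    have "\<xi> \<le> l v \<theta>'" using closed_contains_Inf[OF ne bd l_closed(2)] by (simp add: \<theta>'_def)
    moreover have "\<theta>' \<le> \<theta>" unfolding \<theta>'_def by (rule cInf_lower[OF _ bd]) (simp add: l\<theta>)
    ultimately have l\<theta>': "l v \<theta>' = \<xi>" using l_mono[of \<theta>' \<theta> v] l\<theta> by simp
    have below: "l v a < \<xi>" if "a < \<theta>'" for a
    proof (rule ccontr)
      assume "\<not> l v a < \<xi>"
      then have "\<theta>' \<le> a" unfolding \<theta>'_def by (intro cInf_lower[OF _ bd]) simp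
      with that show False by simp
    qed
    have XX: "X e \<theta>' = X e \<theta>" using X_r_l[OF v stall, of \<theta>'] by (simp add: l\<theta>' \<theta>_def)
    obtain \<delta>1 where \<delta>1: "0 < \<delta>1" "\<And>a. \<bar>a - \<theta>'\<bar> < \<delta>1 \<Longrightarrow> \<bar>X e a - X e \<theta>'\<bar> < \<epsilon>" using X_near by blast
    obtain \<delta>2 where \<delta>2: "0 < \<delta>2" "\<And>a. \<bar>a - \<theta>\<bar> < \<delta>2 \<Longrightarrow> \<bar>X e a - X e \<theta>\<bar> < \<epsilon>" using X_near by blast
    define a1 a2 where "a1 = \<theta>' - \<delta>1 / 2" and "a2 = \<theta> + \<delta>2 / 2"
    have a1: "l v a1 < \<xi>" "\<bar>X e a1 - X e \<theta>\<bar> < \<epsilon>"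
      using below[of a1] \<delta>1(2)[of a1] \<delta>1(1) XX by (auto simp: a1_def)
    have a2: "\<xi> < l v a2" "\<bar>X e a2 - X e \<theta>\<bar> < \<epsilon>"
      using le_r_iff[OF v, of a2 \<xi>] \<delta>2(2)[of a2] \<delta>2(1) by (auto simp: a2_def \<theta>_def)
    have "\<bar>X e (r v y) - X e \<theta>\<bar> < \<epsilon>" if y: "l v a1 \<le> y" "y \<le> l v a2" for y
    proof -
      have "X e (r v (l v a1)) \<le> X e (r v y)" "X e (r v y) \<le> X e (r v (l v a2))"
        using y by (auto intro!: X_mono r_mono[OF v])
      with a1(2) a2(2) show ?thesis by (auto simp: X_r_l[OF v stall])
    qed
    then have "\<bar>X e (r v y) - X e (r v \<xi>)\<bar> < \<epsilon>" if "\<bar>y - \<xi>\<bar> < min (\<xi> - l v a1) (l v a2 - \<xi>)" for y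
      using that unfolding \<theta>_def by (simp add: abs_less_iff)
    then show "\<exists>\<delta>>0. \<forall>y. dist y \<xi> < \<delta> \<longrightarrow> dist (X e (r v y)) (X e (r v \<xi>)) < \<epsilon>"
      using a1(1) a2(1) unfolding dist_real_def by (intro exI[of _ "min (\<xi> - l v a1) (l v a2 - \<xi>)"]) simp
  qed
  obtain k where k: "0 < k" "\<And>h. 0 < h \<Longrightarrow> h \<le> k \<Longrightarrow> (l v (\<theta> + h) = l v \<theta> + h * d v \<theta> \<and> d v (\<theta> + h) = d v \<theta>)
      \<and> (X e (\<theta> + h) = X e \<theta> + h * x e \<theta> \<and> x e (\<theta> + h) = x e \<theta>)"
  proof -
    obtain k1 where k1: "0 < k1" "\<And>h. 0 < h \<Longrightarrow> h \<le> k1 \<Longrightarrow> l v (\<theta> + h) = l v \<theta> + h * d v \<theta> \<and> d v (\<theta> + h) = d v \<theta>"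
      using slopes_linear_piece[OF l_slopes[of v], of \<theta>] by blast
    obtain k2 where k2: "0 < k2" "\<And>h. 0 < h \<Longrightarrow> h \<le> k2 \<Longrightarrow> X e (\<theta> + h) = X e \<theta> + h * x e \<theta> \<and> x e (\<theta> + h) = x e \<theta>"
      using slopes_linear_piece[OF X_slopes[of e], of \<theta>] by blast
    show thesis by (rule that[of "min k1 k2"]) (use k1 k2 in auto)
  qed
  \<comment> \<open>To the right of \<open>\<xi>\<close>, \<open>r v\<close> inverts the linear
    piece of \<open>l v\<close> that starts at \<open>\<theta>\<close> and has positive
    slope.\<close>
  have r_step: "r v (\<xi> + h) = \<theta> + h / d v \<theta>" if h: "0 < h" "h < k * d v \<theta>" for h
  proof (rule antisym)
    define a where "a = h / d v \<theta>"
    have a: "0 < a" "a < k" "a * d v \<theta> = h" using h \<delta> by (auto simp: a_def pos_divide_less_eq)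
    show "\<theta> + h / d v \<theta> \<le> r v (\<xi> + h)"
      using k(2)[of a] a l\<theta> by (simp add: le_r_iff[OF v] a_def[symmetric])
    show "r v (\<xi> + h) \<le> \<theta> + h / d v \<theta>"
    proof (rule ccontr)
      assume "\<not> ?thesis"
      then have "\<theta> + a < r v (\<xi> + h)" by (simp add: a_def)
      define b where "b = min k (r v (\<xi> + h) - \<theta>)"
      have b: "a < b" "b \<le> k" "\<theta> + b \<le> r v (\<xi> + h)" using a \<open>\<theta> + a < r v (\<xi> + h)\<close> by (auto simp: b_def)
      then have "\<xi> + b * d v \<theta> \<le> \<xi> + h" using k(2)[of b] a l\<theta> by (simp add: le_r_iff[OF v])
      then have "b * d v \<theta> \<le> a * d v \<theta>" using a by simp
      with b(1) \<delta> show False by simp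
    qed
  qed
  have "X e (r v (\<xi> + h)) = X e (r v \<xi>) + h * (x e (r v \<xi>) / d v (r v \<xi>)) \<and>
    x e (r v (\<xi> + h)) / d v (r v (\<xi> + h)) = x e (r v \<xi>) / d v (r v \<xi>)" if h: "0 < h" "h < k * d v \<theta>" for h
  proof -
    have "0 < h / d v \<theta>" "h / d v \<theta> \<le> k" using h \<delta> by (auto simp: pos_divide_le_eq)
    with k(2)[of "h / d v \<theta>"] r_step[OF h] show ?thesis by (simp add: \<theta>_def[symmetric])
  qed
  moreover have "0 < k * d v \<theta>" using k(1) \<delta> by simp
  ultimately show "\<forall>\<^sub>F h in at_right 0. X e (r v (\<xi> + h)) = X e (r v \<xi>) + h * (x e (r v \<xi>) / d v (r v \<xi>)) \<and>
    x e (r v (\<xi> + h)) / d v (r v (\<xi> + h)) = x e (r v \<xi>) / d v (r v \<xi>)"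
    unfolding eventually_at_right_field by auto
qed

section \<open>Exceptional times and the rates of the flow\<close>

definition flat :: "'a \<Rightarrow> real set" where
  "flat v = {p. \<exists>a b. a < b \<and> l v a = p \<and> l v b = p}"

text \<open>
  The strong equilibrium condition forces the inflow rate to vanish at the values in \<open>flat\<close>, so
  \<open>rate_in\<close> deviates there from its right-constant representative.
\<close>

definition rate_in :: "'b \<Rightarrow> real \<Rightarrow> real" where
  "rate_in e \<xi> = (if \<xi> \<in> flat (tail G e) then 0
     else x e (r (tail G e) \<xi>) / d (tail G e) (r (tail G e) \<xi>))"

definition rate_out :: "'b \<Rightarrow> real \<Rightarrow> real" where
  "rate_out e \<xi> = x e (r (head G e) \<xi>) / d (head G e) (r (head G e) \<xi>)"

abbreviation flow :: "'b flow" where "flow \<equiv> (rate_in, rate_out)"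

text \<open>Every plateau contains a rational departure time.\<close>

lemma countable_flat: "countable (flat v)"
proof (rule countable_subset)
  show "flat v \<subseteq> l v ` \<rat>"
  proof
    fix p assume "p \<in> flat v"
    then obtain a b where ab: "a < b" "l v a = p" "l v b = p" by (auto simp: flat_def)
    obtain q where q: "q \<in> \<rat>" "a < q" "q < b" using Rats_dense_in_real[OF ab(1)] by blast
    have "l v q = p" using l_mono[of a q v] l_mono[of q b v] q ab by simp
    with q(1) show "p \<in> l v ` \<rat>" by blast
  qed
  show "countable (l v ` \<rat>)" by (simp add: countable_rat)
qed

lemma r_l:
  assumes v: "v \<in> verts G" and "l v \<theta> \<notin> flat v" shows "r v (l v \<theta>) = \<theta>"
proof (rule ccontr)
  have "\<theta> \<le> r v (l v \<theta>)" by (simp add: le_r_iff[OF v])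
  moreover assume "r v (l v \<theta>) \<noteq> \<theta>"
  ultimately have "\<theta> < r v (l v \<theta>)" by simp
  then have "l v \<theta> \<in> flat v" unfolding flat_def using l_r[OF v, of "l v \<theta>"] by blast
  with assms(2) show False by simp
qed

lemma l_less_off_flat:
  assumes "l v b \<notin> flat v" "a < b" shows "l v a < l v b"
proof -
  have "l v a \<le> l v b" using assms(2) by (intro l_mono) simp
  moreover have "l v a \<noteq> l v b" using assms unfolding flat_def by auto
  ultimately show ?thesis by simp
qed

lemma r_source: "r s \<xi> = \<xi>"
  using l_r[OF source_in_verts, of \<xi>] by (simp add: l_source)

lemma X_tail_slopes: "e \<in> arcs G \<Longrightarrow>
    slopes (\<lambda>\<xi>. X e (r (tail G e) \<xi>)) (\<lambda>\<xi>. x e (r (tail G e) \<xi>) / d (tail G e) (r (tail G e) \<xi>))"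
  by (rule X_r_slopes) (auto intro: x_zero_if_tail_stalls)

lemma X_head_slopes: "e \<in> arcs G \<Longrightarrow> slopes (\<lambda>\<xi>. X e (r (head G e) \<xi>)) (rate_out e)"
  unfolding rate_out_def by (rule X_r_slopes) (auto intro: x_zero_if_head_stalls)

lemma X_r_nonpos: "v \<in> verts G \<Longrightarrow> \<xi> \<le> 0 \<Longrightarrow> X e (r v \<xi>) = 0"
  using r_le[of v \<xi>] by (intro X_nonpos) simp

lemma rate_nonneg: "0 \<le> rate_in e \<xi>" "0 \<le> rate_out e \<xi>"
  by (simp_all add: rate_in_def rate_out_def thinD)

lemma rate_in_cumulative:
  assumes "e \<in> arcs G"
  shows "rate_in e absolutely_integrable_on {a..b}" "cumulative (rate_in e) \<xi> = X e (r (tail G e) \<xi>)"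
proof -
  note * = slopes_cumulative[OF X_tail_slopes[OF assms] _ rate_nonneg(1)[of e] countable_flat[of "tail G e"]]
  show "rate_in e absolutely_integrable_on {a..b}"
    by (rule *(1)) (use assms in \<open>auto simp: thinD rate_in_def X_r_nonpos\<close>)
  show "cumulative (rate_in e) \<xi> = X e (r (tail G e) \<xi>)"
    by (rule *(2)) (use assms in \<open>auto simp: thinD rate_in_def X_r_nonpos\<close>)
qed

lemma rate_out_cumulative:
  assumes "e \<in> arcs G"
  shows "rate_out e absolutely_integrable_on {a..b}" "cumulative (rate_out e) \<xi> = X e (r (head G e) \<xi>)"
proof -
  note * = slopes_cumulative[OF X_head_slopes[OF assms] rate_nonneg(2)[of e] rate_nonneg(2)[of e] countable_empty]
  show "rate_out e absolutely_integrable_on {a..b}"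
    by (rule *(1)) (use assms in \<open>auto simp: X_r_nonpos\<close>)
  show "cumulative (rate_out e) \<xi> = X e (r (head G e) \<xi>)"
    by (rule *(2)) (use assms in \<open>auto simp: X_r_nonpos\<close>)
qed

lemma flow_over_time_flow: "flow_over_time G flow"
  unfolding flow_over_time_def F0_def
proof (intro ballI conjI CollectI allI)
  fix e assume e: "e \<in> arcs G"
  have neg: "x e (r v \<theta>) = 0" if "v \<in> verts G" "\<theta> < 0" for v \<theta>
    using r_le[OF that(1), of \<theta>] that(2) by (intro x_zero_neg) simp
  show "AE \<theta> in lebesgue. \<theta> < 0 \<longrightarrow> inflow flow e \<theta> = 0" "AE \<theta> in lebesgue. \<theta> < 0 \<longrightarrow> outflow flow e \<theta> = 0"
    using e by (auto intro!: AE_I2 simp: rate_in_def rate_out_def neg)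
qed (auto simp: rate_nonneg rate_in_cumulative(1) rate_out_cumulative(1))

section \<open>Queues, exit times and earliest times\<close>

lemma tight_at_iff: "e \<in> tight_at \<theta> \<longleftrightarrow> e \<in> arcs G \<and> l (tail G e) \<theta> + \<tau> e \<le> l (head G e) \<theta>"
  by (simp add: tight_def)

text \<open>If capacity alone sets the slope bound, the arc serves at full rate. With
  \<open>x e \<theta> = 0\<close> the bound is 0 and the head stands still.\<close>

lemma x_eq_of_slope_bound:
  assumes e: "e \<in> tight_at \<theta>" and sb: "slope_bound (\<lambda>v. l v \<theta>) e (d (tail G e) \<theta>) (x e \<theta>) = x e \<theta> / \<nu> e"
  shows "x e \<theta> = \<nu> e * d (head G e) \<theta>"
proof (cases "x e \<theta> = 0")
  case True
  then show ?thesis using thinD(6)[OF e] thinD(2)[of "head G e" \<theta>] sb by simp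
next
  case False
  then have "d (head G e) \<theta> = x e \<theta> / \<nu> e" using thinD(7)[of e \<theta>] thinD(3)[of e \<theta>] sb by simp
  then show ?thesis using service_rate_pos[OF tight_arcs[OF e]] by simp
qed

text \<open>What has left the queue by \<open>l v \<theta>\<close> is what departed from
  \<open>s\<close> up to \<open>\<eta>\<close>, so the queue is
  \<open>X e \<theta> - X e \<eta>\<close>. If \<open>\<theta> \<le> \<eta>\<close>, no flow is sent
  in between, since \<open>e\<close> is inactive or its head stalls. Otherwise \<open>e\<close> is
  tight from \<open>\<eta>\<close> to \<open>\<theta>\<close> and serves at full rate.\<close>

lemma queue_at_entry:
  assumes e: "e \<in> arcs G"
  shows "queue \<tau> flow e (l (tail G e) \<theta>) = \<nu> e * max 0 (l (head G e) \<theta> - l (tail G e) \<theta> - \<tau> e)"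
proof -
  define v w \<eta> where "v = tail G e" and "w = head G e" and "\<eta> = r w (l v \<theta> + \<tau> e)"
  have v: "v \<in> verts G" and w: "w \<in> verts G" using e by (auto simp: v_def w_def)
  have l\<eta>: "l w \<eta> = l v \<theta> + \<tau> e" by (simp add: \<eta>_def l_r[OF w])
  have "X e (r v (l v \<theta>)) = X e \<theta>"
    by (rule X_r_l[OF v]) (use e in \<open>auto simp: v_def intro: x_zero_if_tail_stalls\<close>)
  then have q: "queue \<tau> flow e (l v \<theta>) = X e \<theta> - X e \<eta>"
    using e by (simp add: queue_def rate_in_cumulative rate_out_cumulative v_def w_def \<eta>_def)
  show ?thesis
  proof (cases "\<theta> \<le> \<eta>")
    case True
    have "X e \<eta> - X e \<theta> = 0 * (X e \<eta> - X e \<theta>)"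
    proof (rule slopes_eq_diff[OF X_slopes X_slopes True])
      fix \<zeta> assume \<zeta>: "\<theta> \<le> \<zeta>" "\<zeta> < \<eta>"
      show "x e \<zeta> = 0 * x e \<zeta>"
      proof (cases "l w \<zeta> = l w \<eta>")
        case True
        with flat_imp_d_zero[OF \<zeta>(2) True] e show ?thesis by (simp add: x_zero_if_head_stalls w_def)
      next
        case False
        then have "l w \<zeta> < l v \<theta> + \<tau> e" using l_mono[of \<zeta> \<eta> w] \<zeta> l\<eta> by simp
        also have "\<dots> \<le> l v \<zeta> + \<tau> e" using l_mono[OF \<zeta>(1)] by simp
        finally have "e \<notin> tight_at \<zeta>" by (simp add: tight_at_iff v_def w_def)
        then show ?thesis by (simp add: thinD)
      qed
    qed
    moreover have "l w \<theta> \<le> l v \<theta> + \<tau> e" using l_mono[OF True, of w] l\<eta> by simp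
    ultimately show ?thesis using q by (simp add: v_def w_def)
  next
    case False
    then have lt: "\<eta> < \<theta>" by simp
    have "X e \<theta> - X e \<eta> = \<nu> e * (l w \<theta> - l w \<eta>)"
    proof (rule slopes_eq_diff[OF X_slopes l_slopes])
      fix \<zeta> assume \<zeta>: "\<eta> \<le> \<zeta>" "\<zeta> < \<theta>"
      have le: "l v \<zeta> \<le> l v \<theta>" "l w \<eta> \<le> l w \<zeta>" using \<zeta> by (auto intro: l_mono)
      have tight: "e \<in> tight_at \<zeta>" using le l\<eta> e by (simp add: tight_at_iff v_def w_def)
      show "x e \<zeta> = \<nu> e * d w \<zeta>" unfolding w_def
      proof (rule x_eq_of_slope_bound[OF tight])
        show "slope_bound (\<lambda>v. l v \<zeta>) e (d (tail G e) \<zeta>) (x e \<zeta>) = x e \<zeta> / \<nu> e"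
        proof (cases "l v \<zeta> + \<tau> e < l w \<zeta>")
          case True
          then show ?thesis by (simp add: slope_bound_def v_def w_def)
        next
          case False
          \<comment> \<open>Without a strict gap the tail stalls, so its speed 0 does not affect the
            maximum in \<open>slope_bound\<close>.\<close>
          then have "l v \<zeta> = l v \<theta>" using le l\<eta> by simp
          from flat_imp_d_zero[OF \<zeta>(2) this] have "d (tail G e) \<zeta> = 0" by (simp add: v_def)
          then show ?thesis using thinD(3)[of e \<zeta>] service_rate_pos[OF e] by (simp add: slope_bound_def)
        qed
      qed
    qed (use lt in simp)
    moreover have "l v \<theta> + \<tau> e < l w \<theta>" using lt le_r_iff[OF w, of \<theta> "l v \<theta> + \<tau> e"] by (simp add: \<eta>_def)
    ultimately show ?thesis using q l\<eta> by (simp add: v_def w_def max_def)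
  qed
qed

lemma exit_time_at_entry:
  assumes e: "e \<in> arcs G"
  shows "exit_time \<nu> \<tau> flow e (l (tail G e) \<theta>) = max (l (tail G e) \<theta> + \<tau> e) (l (head G e) \<theta>)"
  using service_rate_pos[OF e] by (auto simp: exit_time_def queue_at_entry[OF e] max_def)

text \<open>Generalised to walks from any \<open>v\<close> entered no earlier than
  \<open>l v \<theta>\<close>, so that induction over the walk goes through.\<close>

lemma path_exit_time_ge:
  assumes "awalk v P w" "l v \<theta> \<le> \<xi>"
  shows "l w \<theta> \<le> path_exit_time \<nu> \<tau> flow P \<xi>"
  using assms
proof (induction P arbitrary: v \<xi>)
  case Nil
  then show ?case by (simp add: awalk_Nil_iff path_exit_time_def)
next
  case (Cons e P)
  then have e: "e \<in> arcs G" "v = tail G e" "awalk (head G e) P w" by (auto simp: awalk_Cons_iff)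
  have v: "v \<in> verts G" using e by simp
  \<comment> \<open>Writing \<open>\<xi>\<close> as a label makes \<open>exit_time_at_entry\<close>
    applicable. If \<open>l v \<theta> = \<xi>\<close>, the choice \<open>a = \<theta>\<close>
    secures \<open>\<theta> \<le> a\<close>.\<close>
  obtain a where a: "l v a = \<xi>" "\<theta> \<le> a"
  proof (cases "l v \<theta> = \<xi>")
    case False
    obtain a where "l v a = \<xi>" using l_surj[OF v] by blast
    moreover have "\<theta> \<le> a" using l_mono[of a \<theta> v] Cons.prems(2) False calculation by (meson le_less_linear less_imp_le antisym)
    ultimately show thesis by (rule that)
  qed (use that in blast)
  have "l (head G e) \<theta> \<le> exit_time \<nu> \<tau> flow e \<xi>"
    using exit_time_at_entry[OF e(1), of a] l_mono[OF a(2), of "head G e"] a(1) e(2) by simp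
  from Cons.IH[OF e(3) this] show ?case by (simp add: path_exit_time_def)
qed

text \<open>Tight arcs entered at the label of the tail are left exactly at that of the head. The
  last conjunct keeps the path simple: a second visit to \<open>w\<close> would close a tight
  cycle.\<close>

lemma tight_path_exists:
  assumes "w \<in> verts G"
  shows "\<exists>P. apath s P w \<and> path_exit_time \<nu> \<tau> flow P \<theta> = l w \<theta>
    \<and> set (awalk_verts s P) \<subseteq> {y. (y, w) \<in> (tight_rel (\<lambda>v. l v \<theta>))\<^sup>*}"
  using assms
proof (induction w rule: wf_induct_rule[OF wf_tight_rel[of "\<lambda>v. l v \<theta>"]])
  case (1 w)
  let ?R = "tight_rel (\<lambda>v. l v \<theta>)"
  show ?case
  proof (cases "w = s")
    case True
    have "apath s [] s" by (simp add: apath_Nil_iff source_in_verts)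
    with True show ?thesis by (intro exI[of _ "[]"]) (simp add: path_exit_time_def l_source)
  next
    case False
    then obtain e where e: "e \<in> tight_at \<theta>" "head G e = w"
      using thin_flow_spanning[OF thin] 1(2) by (auto simp: tight_spanning_def)
    define v where "v = tail G e"
    have a: "e \<in> arcs G" and v: "v \<in> verts G" and vw: "(v, w) \<in> ?R"
      using tight_arcs[OF e(1)] tight_relI[OF e(1)] e(2) by (auto simp: v_def)
    obtain P where P: "apath s P v" "path_exit_time \<nu> \<tau> flow P \<theta> = l v \<theta>"
      "set (awalk_verts s P) \<subseteq> {y. (y, v) \<in> ?R\<^sup>*}" using 1(1)[OF vw v] by blast
    have walk: "awalk s P v" "distinct (awalk_verts s P)" using P(1) by (auto simp: apath_def)
    have "awalk v [e] w" using a e(2) 1(2) by (simp add: awalk_simps v_def)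
    then have walk': "awalk s (P @ [e]) w" using walk(1) by (rule awalk_appendI[rotated])
    then have verts: "awalk_verts s (P @ [e]) = awalk_verts s P @ [w]"
      using awalk_verts_append[OF walk'] walk(1) e(2) by simp
    have "w \<notin> set (awalk_verts s P)"
    proof
      assume "w \<in> set (awalk_verts s P)"
      then have "(w, v) \<in> ?R\<^sup>*" using P(3) by blast
      with vw have "(w, w) \<in> ?R\<^sup>+" by (rule rtrancl_into_trancl1[rotated])
      with wf_acyclic[OF wf_tight_rel] show False by (auto simp: acyclic_def)
    qed
    then have "apath s (P @ [e]) w" using walk' walk(2) by (simp add: apath_def verts)
    moreover have "path_exit_time \<nu> \<tau> flow (P @ [e]) \<theta> = l w \<theta>"
      using exit_time_at_entry[OF a, of \<theta>] e P(2) by (simp add: path_exit_time_def v_def tight_at_iff max_def)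
    moreover have "set (awalk_verts s (P @ [e])) \<subseteq> {y. (y, w) \<in> ?R\<^sup>*}"
      using P(3) vw by (auto simp: verts intro: rtrancl_into_rtrancl)
    ultimately show ?thesis by blast
  qed
qed

lemma earliest_time_flow:
  assumes "w \<in> verts G" shows "earliest_time G \<nu> \<tau> s flow w \<theta> = l w \<theta>"
  unfolding earliest_time_def
proof (rule Min_eqI)
  show "finite ((\<lambda>P. path_exit_time \<nu> \<tau> flow P \<theta>) ` {P. apath s P w})"
    by (intro finite_imageI apaths_finite)
  show "l w \<theta> \<le> y" if "y \<in> (\<lambda>P. path_exit_time \<nu> \<tau> flow P \<theta>) ` {P. apath s P w}" for y
    using that by (auto intro!: path_exit_time_ge simp: apath_def l_source)
  show "l w \<theta> \<in> (\<lambda>P. path_exit_time \<nu> \<tau> flow P \<theta>) ` {P. apath s P w}"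
    using tight_path_exists[OF assms, of \<theta>] by force
qed

section \<open>The equilibrium conditions\<close>

lemma feasible_flow: "feasible G \<nu> \<tau> s t u flow"
  unfolding feasible_def
proof (rule AE_lebesgue_off_countable[of "\<Union>v\<in>verts G. flat v"]; (intro conjI ballI)?)
  show "countable (\<Union>v\<in>verts G. flat v)" by (simp add: countable_flat countable_finite)
next
  fix \<xi> e assume e: "e \<in> arcs G"
  define w \<theta> where "w = head G e" and "\<theta> = r w \<xi>"
  have d: "0 < d w \<theta>" using d_pos_r[of w \<xi>] e by (simp add: w_def \<theta>_def)
  have "x e \<theta> \<le> \<nu> e * d w \<theta>"
  proof (cases "x e \<theta> = 0")
    case False
    then have "x e \<theta> / \<nu> e \<le> d w \<theta>" using thinD(7)[of e \<theta>] thinD(3)[of e \<theta>] slope_bound_ge by (simp add: w_def)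
    then show ?thesis using service_rate_pos[OF e] by (simp add: pos_divide_le_eq mult.commute)
  qed (use d service_rate_pos[OF e] in simp)
  then show "outflow flow e \<xi> \<le> \<nu> e"
    using d by (simp add: rate_out_def w_def[symmetric] \<theta>_def[symmetric] pos_divide_le_eq)
  obtain a where "l (tail G e) a = \<xi>" using l_surj[of "tail G e"] e by auto
  with queue_at_entry[OF e, of a] service_rate_pos[OF e] show "0 \<le> queue \<tau> flow e \<xi>" by simp
next
  fix \<xi> v assume \<xi>: "\<xi> \<notin> (\<Union>v\<in>verts G. flat v)" and v: "v \<in> verts G - {t}"
  \<comment> \<open>All rates at \<open>v\<close> at time \<open>\<xi>\<close> belong to the same
    departure time and are divided by the same speed, so conservation is inherited from the thin
    flow.\<close>
  define \<theta> where "\<theta> = r v \<xi>"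
  have "(\<Sum>e\<in>out_arcs G v. inflow flow e \<xi>) = (\<Sum>e\<in>out_arcs G v. x e \<theta> / d v \<theta>)"
    by (rule sum.cong) (use \<xi> v in \<open>auto simp: rate_in_def \<theta>_def\<close>)
  moreover have "(\<Sum>e\<in>in_arcs G v. outflow flow e \<xi>) = (\<Sum>e\<in>in_arcs G v. x e \<theta> / d v \<theta>)"
    by (rule sum.cong) (auto simp: rate_out_def \<theta>_def)
  ultimately have "(\<Sum>e\<in>out_arcs G v. inflow flow e \<xi>) - (\<Sum>e\<in>in_arcs G v. outflow flow e \<xi>)
      = (if v = s then u \<theta> else 0) / d v \<theta>"
    using thinD(8)[of v \<theta>] v by (simp add: sum_divide_distrib[symmetric] diff_divide_distrib[symmetric])
  then show "(\<Sum>e\<in>out_arcs G v. inflow flow e \<xi>) - (\<Sum>e\<in>in_arcs G v. outflow flow e \<xi>) = (if v = s then u \<xi> else 0)"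
    by (simp add: \<theta>_def r_source thinD split: if_splits)
qed

text \<open>Compare the departure times from \<open>s\<close> of what enters \<open>e\<close> at
  \<open>\<xi>\<close> and of what leaves it at \<open>\<xi> + \<tau> e\<close>, called
  \<open>\<theta>\<close> and \<open>\<eta>\<close>. A queue is present if
  \<open>\<eta> < \<theta>\<close>; if they agree, the thin flow rule applies; if
  \<open>\<theta> < \<eta>\<close>, both rates vanish.\<close>

lemma capacity_flow: "queues_operate_at_capacity G \<nu> \<tau> flow"
  unfolding queues_operate_at_capacity_def
proof
  fix e assume e: "e \<in> arcs G"
  define v w where "v = tail G e" and "w = head G e"
  have v: "v \<in> verts G" and w: "w \<in> verts G" using e by (auto simp: v_def w_def)
  have \<nu>: "0 < \<nu> e" using service_rate_pos[OF e] .
  show "AE \<theta> in lebesgue. outflow flow e (\<theta> + \<tau> e)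
      = (if 0 < queue \<tau> flow e \<theta> then \<nu> e else min (inflow flow e \<theta>) (\<nu> e))"
  proof (rule AE_lebesgue_off_countable[OF countable_flat[of v]])
    fix \<xi> assume \<xi>: "\<xi> \<notin> flat v"
    define \<theta> \<eta> where "\<theta> = r v \<xi>" and "\<eta> = r w (\<xi> + \<tau> e)"
    have l: "l v \<theta> = \<xi>" "l w \<eta> = \<xi> + \<tau> e" by (simp_all add: \<theta>_def \<eta>_def l_r v w)
    have d: "0 < d v \<theta>" "0 < d w \<eta>" by (simp_all add: \<theta>_def \<eta>_def d_pos_r v w)
    have fin: "inflow flow e \<xi> = x e \<theta> / d v \<theta>" using \<xi> by (simp add: rate_in_def v_def \<theta>_def)
    have fout: "outflow flow e (\<xi> + \<tau> e) = x e \<eta> / d w \<eta>" by (simp add: rate_out_def w_def \<eta>_def)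
    have q: "0 < queue \<tau> flow e \<xi> \<longleftrightarrow> \<xi> + \<tau> e < l w \<theta>"
      using queue_at_entry[OF e, of \<theta>] l(1) \<nu> by (auto simp: v_def w_def zero_less_mult_iff max_def)
    consider "\<eta> < \<theta>" | "\<eta> = \<theta>" | "\<theta> < \<eta>" by linarith
    then show "outflow flow e (\<xi> + \<tau> e) = (if 0 < queue \<tau> flow e \<xi> then \<nu> e else min (inflow flow e \<xi>) (\<nu> e))"
    proof cases
      case 1
      \<comment> \<open>Strict because \<open>\<xi>\<close> is not the value of a plateau of
        \<open>l v\<close>.\<close>
      then have "l v \<eta> < \<xi>" using l_less_off_flat[of v \<theta> \<eta>] \<xi> l by simp
      then have "l (tail G e) \<eta> + \<tau> e < l (head G e) \<eta>" using l by (simp add: v_def w_def)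
      then have "x e \<eta> = \<nu> e * d w \<eta>" unfolding w_def using e
        by (intro x_eq_of_slope_bound) (auto simp: tight_at_iff slope_bound_def)
      moreover have "\<xi> + \<tau> e < l w \<theta>" using le_r_iff[OF w, of \<theta> "\<xi> + \<tau> e"] 1 by (simp add: \<eta>_def)
      ultimately show ?thesis using q fout d(2) by simp
    next
      case 2
      then have lw: "l w \<theta> = l v \<theta> + \<tau> e" using l by simp
      then have nq: "\<not> 0 < queue \<tau> flow e \<xi>" using q l by simp
      have sb: "slope_bound (\<lambda>v. l v \<theta>) e (d (tail G e) \<theta>) (x e \<theta>) = max (d v \<theta>) (x e \<theta> / \<nu> e)"
        using lw by (simp add: slope_bound_def v_def w_def)
      show ?thesis
      proof (cases "x e \<theta> = 0")
        case True
        then show ?thesis using nq fin fout 2 \<nu> by simp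
      next
        case False
        then have pos: "0 < x e \<theta>" using thinD(3)[of e \<theta>] by simp
        from thinD(7)[OF this] have dw: "d w \<theta> = max (d v \<theta>) (x e \<theta> / \<nu> e)" unfolding sb by (simp add: w_def)
        \<comment> \<open>Dividing by the maximum of two speeds gives the minimum of the two rates:
          the thin flow rule becomes the outflow rule of an empty queue.\<close>
        have "x e \<theta> / d w \<theta> = min (x e \<theta> / d v \<theta>) (\<nu> e)"
        proof (cases "d v \<theta> \<le> x e \<theta> / \<nu> e")
          case True
          then have "\<nu> e \<le> x e \<theta> / d v \<theta>" using d \<nu> by (simp add: pos_le_divide_eq mult.commute)
          with True dw pos show ?thesis by simp
        next
          case False
          then have "x e \<theta> / d v \<theta> \<le> \<nu> e" using d \<nu> by (simp add: pos_divide_le_eq pos_le_divide_eq mult.commute not_le)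
          with False dw show ?thesis by simp
        qed
        with nq fin fout 2 show ?thesis by simp
      qed
    next
      case 3
      have "l v \<theta> < l v \<eta>" using le_r_iff[OF v, of \<eta> \<xi>] 3 l by (simp add: \<theta>_def)
      then have "e \<notin> tight_at \<eta>" using l by (simp add: tight_at_iff v_def w_def)
      then have out: "outflow flow e (\<xi> + \<tau> e) = 0" using fout by (simp add: thinD)
      have le: "l w \<theta> \<le> \<xi> + \<tau> e" using l_mono[of \<theta> \<eta> w] 3 l by simp
      have "x e \<theta> = 0"
      proof (cases "l w \<theta> = l w \<eta>")
        case True
        from flat_imp_d_zero[OF 3 this] e show ?thesis by (simp add: w_def x_zero_if_head_stalls)
      next
        case False
        then have "e \<notin> tight_at \<theta>" using le l by (simp add: tight_at_iff v_def w_def)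
        then show ?thesis by (simp add: thinD)
      qed
      with out le q fin \<nu> show ?thesis by simp
    qed
  qed
qed

text \<open>Active arcs are the tight ones, and the condition holds at every
  \<open>\<theta>\<close>: at a value in \<open>flat\<close> the rate is 0 by definition, elsewhere
  \<open>r v\<close> recovers \<open>\<theta>\<close>, at which \<open>x e\<close> is 0.\<close>

lemma strong_equilibrium_flow: "strong_dynamic_equilibrium G \<nu> \<tau> s t u flow"
  unfolding strong_dynamic_equilibrium_def
proof (intro conjI ballI flow_over_time_flow feasible_flow capacity_flow AE_I2 impI)
  fix e \<theta> assume e: "e \<in> arcs G" "e \<notin> active G \<nu> \<tau> s flow \<theta>"
  then have "e \<notin> tight_at \<theta>"
    by (simp add: active_def earliest_time_flow exit_time_at_entry tight_at_iff)
  then have "x e \<theta> = 0" by (simp add: thinD)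
  then show "inflow flow e (earliest_time G \<nu> \<tau> s flow (tail G e) \<theta>) = 0"
    using e(1) by (simp add: earliest_time_flow rate_in_def r_l)
qed

lemma right_constant_rates:
  assumes "e \<in> arcs G"
  shows "right_constant_AE (rate_in e)" "right_constant (rate_out e)"
proof -
  show "right_constant (rate_out e)" by (rule slopes_right_constant[OF X_head_slopes[OF assms]])
  have "AE \<xi> in lebesgue. rate_in e \<xi> = x e (r (tail G e) \<xi>) / d (tail G e) (r (tail G e) \<xi>)"
    by (rule AE_lebesgue_off_countable[OF countable_flat[of "tail G e"]]) (simp add: rate_in_def)
  with slopes_right_constant[OF X_tail_slopes[OF assms]] show "right_constant_AE (rate_in e)"
    unfolding right_constant_AE_def by blast
qed

end

theorem theorem11:
  fixes G :: "('a, 'b) pre_digraph"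
    and \<nu> \<tau> :: "'b \<Rightarrow> real"
    and s t :: 'a
    and u :: "real \<Rightarrow> real"
    and \<xi> :: "nat \<Rightarrow> real"
  assumes "network G \<nu> \<tau> s t"
    and "u \<in> F0"
    and "incseq \<xi>" and "\<xi> 0 = 0" and "filterlim \<xi> at_top sequentially"
    and "\<And>k. u constant_on {\<xi> k..<\<xi> (Suc k)}"
    and "\<And>\<theta>. \<theta> < 0 \<Longrightarrow> u \<theta> = 0"
  shows "\<exists>f. strong_dynamic_equilibrium G \<nu> \<tau> s t u f
           \<and> (\<forall>e\<in>arcs G. right_constant_AE (inflow f e) \<and> right_constant (outflow f e))
           \<and> (\<forall>v\<in>verts G. right_linear (earliest_time G \<nu> \<tau> s f v))"
proof -
  interpret network G \<nu> \<tau> s t by fact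
  note reg = step_function_regular[OF assms(3-7)]
  have nonneg: "0 \<le> u \<theta>" for \<theta> using assms(2) by (simp add: F0_def)
  obtain l d X x where *: "\<And>v. slopes (l v) (d v)" "\<And>e. slopes (X e) (x e)" "\<And>\<theta>. l s \<theta> = \<theta>"
    "\<And>\<theta>. thin_flow (\<lambda>v. l v \<theta>) (u \<theta>) (\<lambda>v. d v \<theta>) (\<lambda>e. x e \<theta>)"
    "\<And>v \<theta>. v \<in> verts G \<Longrightarrow> \<theta> \<le> 0 \<Longrightarrow> l v \<theta> = l v 0 + \<theta>"
    "\<And>e \<theta>. \<theta> \<le> 0 \<Longrightarrow> X e \<theta> = 0"
  proof (rule thin_flow_trajectory_exists[of u])
    show "\<forall>\<^sub>F h in at_right 0. u (\<theta> + h) = u \<theta>" for \<theta> by (rule reg)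
    show "bdd_above (u ` {0..\<theta>})" for \<theta> by (rule reg)
    show "0 \<le> u \<theta>" for \<theta> by (rule nonneg)
    show "u \<theta> = 0" if "\<theta> < 0" for \<theta> using that by (rule assms(7))
    fix l d :: "'a \<Rightarrow> real \<Rightarrow> real" and X x :: "'b \<Rightarrow> real \<Rightarrow> real"
    assume "\<And>v. slopes (l v) (d v)" "\<And>e. slopes (X e) (x e)" "\<And>\<theta>. l s \<theta> = \<theta>"
      "\<And>\<theta>. thin_flow (\<lambda>v. l v \<theta>) (u \<theta>) (\<lambda>v. d v \<theta>) (\<lambda>e. x e \<theta>)"
      "\<And>v \<theta>. v \<in> verts G \<Longrightarrow> \<theta> \<le> 0 \<Longrightarrow> l v \<theta> = l v 0 + \<theta>"
      "\<And>e \<theta>. \<theta> \<le> 0 \<Longrightarrow> X e \<theta> = 0"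
    then show thesis by (rule that[of l d X x])
  qed
  interpret T: thin_flow_trajectory G \<nu> \<tau> s t u l d X x
    by unfold_locales (fact *)+
  have "right_linear (earliest_time G \<nu> \<tau> s T.flow v)" if "v \<in> verts G" for v
  proof -
    have "earliest_time G \<nu> \<tau> s T.flow v = l v" using T.earliest_time_flow[OF that] by blast
    then show ?thesis using slopes_right_linear[OF *(1)] by simp
  qed
  with T.strong_equilibrium_flow T.right_constant_rates show ?thesis
    by (intro exI[of _ T.flow]) simp
qed

end
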